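(* The optimal control problem: minimize $\mathcal{J}(\boldsymbol{y},\mathbf{u})$ over $(\boldsymbol{y},\mathbf{u})\in \mathbf{H}_0(\mathbf{curl},\Omega)\times U_{ad}$ subject to $$(\mu^{-1}\mathbf{curl}\,\boldsymbol{y},\mathbf{curl}\,\boldsymbol{w})_\Omega-\omega^2((\varepsilon_\sigma\cdot\mathbf{u})\boldsymbol{y},\boldsymbol{w})_\Omega=(\boldsymbol{f},\boldsymbol{w})_\Omega\quad\forall \boldsymbol{w}\in\mathbf{H}_0(\mathbf{curl},\Omega),$$ admits at least one global solution $(\boldsymbol{y}^*,\mathbf{u}^* )\in\mathbf{H}_0(\mathbf{curl},\Omega)\times U_{ad}$.
   Context: $\Omega\subset\mathbb{R}^3$ is an open, bounded, simply connected polyhedral domain with Lipschitz boundary $\Gamma$ and outward unit normal $\boldsymbol{n}$. $\mathbf{L}^2(\Omega;\mathbb{C})$ is the space of $\mathbb{C}^3$-valued square integrable fields; $(\boldsymbol v,\boldsymbol w)_\Omega=\int_\Omega \boldsymbol v\cdot\overline{\boldsymbol w}$ and $\|\cdot\|_\Omega$ are its inner product and norm. $\mathbf{H}(\mathbf{curl},\Omega)=\{\boldsymbol{w}\in\mathbf{L}^2(\Omega;\mathbb{C}):\mathbf{curl}\,\boldsymbol{w}\in\mathbf{L}^2(\Omega;\mathbb{C})\}$ with its graph norm, and $\mathbf{H}_0(\mathbf{curl},\Omega)=\{\boldsymbol{w}\in\mathbf{H}(\mathbf{curl},\Omega):\boldsymbol{w}\times\boldsymbol{n}=\mathbf{0}\text{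 on }\Gamma\}$. Data: $\omega>0$; $\mu\in L^\infty(\Omega)$ real with $\mu\ge\mu_0>0$; $\varepsilon,\sigma\in L^\infty(\Omega)$ real with $0<\varepsilon_+\le\varepsilon\le\varepsilon^+$ and $0<\sigma_+\le\sigma\le\sigma^+$ (constants); $\varepsilon_\sigma:=\varepsilon+i\sigma\omega^{-1}$; $\ell\in\mathbb{N}$; $\mathcal{P}=\{\Omega_k\}_{k=1}^\ell$ is a partition of $\Omega$ into pairwise disjoint subdomains with $\overline\Omega=\cup_k\overline{\Omega}_k$. For $\mathbf{u}\in\mathbb{R}^\ell$, $\varepsilon_\sigma\cdot\mathbf{u}$ denotes the function equal to $\mathbf{u}_k\varepsilon_\sigma$ on $\Omega_k$, $k=1,\dots,\ell$. $\boldsymbol{f},\boldsymbol{y}_\Omega,\boldsymbol{E}_\Omega\in\mathbf{L}^2(\Omega;\mathbb{C})$ and $\alpha>0$. Vector inequalities are componentwise; $\mathbf{a},\mathbf{b}\in\mathbb{R}^\ell$ with $\mathbf{0}<\mathbf{a}<\mathbf{b}$ and $U_{ad}:=\{\mathbf{v}\in\mathbb{R}^\ell:\mathbf{a}\le\mathbf{v}\le\mathbf{b}\}$. Cost functional: $\mathcal{J}(\boldsymbol{y},\mathbf{u})=\tfrac12\|\boldsymbol{y}-\boldsymbol{y}_\Omega\|_\Omega^2+\tfrac12\|\mathbf{curl}\,\boldsymbol{y}-\boldsymbol{E}_\Omega\|_\Omega^2+\tfrac{\alpha}{2}\|\mathbf{u}\|_{\mathbb{R}^\ell}^2$. *)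

theory Defs
  imports "HOL-Analysis.Analysis"
begin

text \<open>
  Functions on \<open>\<Omega>\<close> are represented by Lebesgue measurable representatives on the whole of
  \<open>\<real>\<^sup>3\<close>; only their values on \<open>\<Omega>\<close>, up to null sets, matter.
\<close>

type_synonym field = "real^3 \<Rightarrow> complex^3"

subsection \<open>Lipschitz polyhedral domains and partitions\<close>

text \<open>
  Near every boundary point the domain is, in suitable orthonormal coordinates, the set of points
  strictly below the graph of a Lipschitz function \<open>g\<close>. Here \<open>e\<close> is the vertical direction and
  \<open>x - (e \<bullet> x) *\<^sub>R e\<close> the orthogonal projection of \<open>x\<close> to the hyperplane orthogonal to \<open>e\<close>.
\<close>

definition lipschitz_boundary :: "(real^3) set \<Rightarrow> bool" where
  "lipschitz_boundary \<Omega> \<longleftrightarrow>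
     (\<forall>x0\<in>frontier \<Omega>. \<exists>U e g L. open U \<and> x0 \<in> U \<and> norm e = 1 \<and>
        L-lipschitz_on {z. e \<bullet> z = 0} g \<and>
        \<Omega> \<inter> U = {x \<in> U. e \<bullet> x < g (x - (e \<bullet> x) *\<^sub>R e)})"

definition polyhedral_domain :: "(real^3) set \<Rightarrow> bool" where
  "polyhedral_domain \<Omega> \<longleftrightarrow>
     open \<Omega> \<and> connected \<Omega> \<and> \<Omega> \<noteq> {} \<and>
     (\<exists>T. finite T \<and> (\<forall>K\<in>T. polytope K) \<and> closure \<Omega> = \<Union>T)"

definition subdomain_partition :: "(real^3) set \<Rightarrow> ('l::finite \<Rightarrow> (real^3) set) \<Rightarrow> bool" where
  "subdomain_partition \<Omega> P \<longleftrightarrow>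
     (\<forall>k. open (P k) \<and> connected (P k) \<and> P k \<noteq> {} \<and> P k \<subseteq> \<Omega>) \<and>
     (\<forall>j k. j \<noteq> k \<longrightarrow> P j \<inter> P k = {}) \<and>
     closure \<Omega> = (\<Union>k. closure (P k))"

subsection \<open>Lebesgue spaces\<close>

definition Linfty :: "(real^3) set \<Rightarrow> (real^3 \<Rightarrow> real) set" where
  "Linfty \<Omega> = {c \<in> borel_measurable (lebesgue_on \<Omega>).
     \<exists>C. AE x in lebesgue_on \<Omega>. \<bar>c x\<bar> \<le> C}"

definition L2 :: "(real^3) set \<Rightarrow> field set" where
  "L2 \<Omega> = {v \<in> borel_measurable (lebesgue_on \<Omega>).
     integrable (lebesgue_on \<Omega>) (\<lambda>x. (norm (v x))\<^sup>2)}"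

definition L2_inner :: "(real^3) set \<Rightarrow> field \<Rightarrow> field \<Rightarrow> complex" where
  "L2_inner \<Omega> v w = (LINT x|lebesgue_on \<Omega>. (\<Sum>i\<in>UNIV. v x $ i * cnj (w x $ i)))"

definition L2_norm :: "(real^3) set \<Rightarrow> field \<Rightarrow> real" where
  "L2_norm \<Omega> v = sqrt (LINT x|lebesgue_on \<Omega>. (norm (v x))\<^sup>2)"

subsection \<open>Test fields and weak derivatives\<close>

primrec times_cont_diff :: "nat \<Rightarrow> ('a::euclidean_space \<Rightarrow> 'b::real_normed_vector) \<Rightarrow> bool" where
  "times_cont_diff 0 f \<longleftrightarrow> continuous_on UNIV f"
| "times_cont_diff (Suc n) f \<longleftrightarrow>
     f differentiable_on UNIV \<and>
     (\<forall>v. times_cont_diff n (\<lambda>x. frechet_derivative f (at x) v))"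

definition test_fields :: "(real^3) set \<Rightarrow> field set" where
  "test_fields \<Omega> = {\<phi>. (\<forall>n. times_cont_diff n \<phi>) \<and>
     compact (closure {x. \<phi> x \<noteq> 0}) \<and> closure {x. \<phi> x \<noteq> 0} \<subseteq> \<Omega>}"

definition partial_deriv :: "3 \<Rightarrow> field \<Rightarrow> field" where
  "partial_deriv j \<phi> x = frechet_derivative \<phi> (at x) (axis j 1)"

definition classical_curl :: "field \<Rightarrow> field" where
  "classical_curl \<phi> x = vector
     [partial_deriv 2 \<phi> x $ 3 - partial_deriv 3 \<phi> x $ 2,
      partial_deriv 3 \<phi> x $ 1 - partial_deriv 1 \<phi> x $ 3,
      partial_deriv 1 \<phi> x $ 2 - partial_deriv 2 \<phi> x $ 1]"

text \<open>
  Since test fields are complex valued and closed under conjugation, pairing with the sesquilinear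
  inner product gives the usual distributional derivatives.
\<close>

definition has_weak_curl :: "(real^3) set \<Rightarrow> field \<Rightarrow> field \<Rightarrow> bool" where
  "has_weak_curl \<Omega> w c \<longleftrightarrow>
     (\<forall>\<phi>\<in>test_fields \<Omega>. L2_inner \<Omega> w (classical_curl \<phi>) = L2_inner \<Omega> c \<phi>)"

definition has_weak_partial :: "(real^3) set \<Rightarrow> 3 \<Rightarrow> field \<Rightarrow> field \<Rightarrow> bool" where
  "has_weak_partial \<Omega> j w g \<longleftrightarrow>
     (\<forall>\<phi>\<in>test_fields \<Omega>. L2_inner \<Omega> w (partial_deriv j \<phi>) = - L2_inner \<Omega> g \<phi>)"

definition H_curl :: "(real^3) set \<Rightarrow> field set" where
  "H_curl \<Omega> = {w \<in> L2 \<Omega>. \<exists>c\<in>L2 \<Omega>. has_weak_curl \<Omega> w c}"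

text \<open>
  The weak curl is unique only up to null sets; \<open>curl\<close> selects a representative.
\<close>

definition curl :: "(real^3) set \<Rightarrow> field \<Rightarrow> field" where
  "curl \<Omega> w = (SOME c. c \<in> L2 \<Omega> \<and> has_weak_curl \<Omega> w c)"

definition H1 :: "(real^3) set \<Rightarrow> field set" where
  "H1 \<Omega> = {w \<in> L2 \<Omega>. \<forall>j. \<exists>g\<in>L2 \<Omega>. has_weak_partial \<Omega> j w g}"

text \<open>
  For \<open>w\<close> in \<open>H(curl,\<Omega>)\<close> the tangential trace \<open>w \<times> n\<close> is an element of \<open>H\<^sup>-\<^sup>1\<^sup>/\<^sup>2(\<Gamma>)\<close>, the dual
  of the trace space of \<open>H\<^sup>1(\<Omega>)\<close>. It is defined by Green's formula: integrating
  \<open>div (w \<times> cnj \<phi>) = curl w \<bullet> cnj \<phi> - w \<bullet> curl (cnj \<phi>)\<close> over \<open>\<Omega>\<close>, where \<open>n\<close> is the outward unit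
  normal, gives for smooth \<open>w\<close> and \<open>\<phi>\<close> that the expression below is the boundary integral of
  \<open>(w \<times> n) \<bullet> cnj \<phi>\<close>.
\<close>

definition tangential_trace :: "(real^3) set \<Rightarrow> field \<Rightarrow> field \<Rightarrow> complex" where
  "tangential_trace \<Omega> w \<phi> = L2_inner \<Omega> w (curl \<Omega> \<phi>) - L2_inner \<Omega> (curl \<Omega> w) \<phi>"

definition H0_curl :: "(real^3) set \<Rightarrow> field set" where
  "H0_curl \<Omega> = {w \<in> H_curl \<Omega>. \<forall>\<phi>\<in>H1 \<Omega>. tangential_trace \<Omega> w \<phi> = 0}"

subsection \<open>The control problem\<close>

definition complex_permittivity ::
    "real \<Rightarrow> (real^3 \<Rightarrow> real) \<Rightarrow> (real^3 \<Rightarrow> real) \<Rightarrow> real^3 \<Rightarrow> complex" where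
  "complex_permittivity \<omega> \<epsilon> \<sigma> x = of_real (\<epsilon> x) + \<i> * of_real (\<sigma> x) * of_real (inverse \<omega>)"

text \<open>
  The product \<open>c \<cdot> u\<close>, equal to \<open>u\<^sub>k c\<close> on the \<open>k\<close>-th subdomain. On the interfaces, i.e. the points
  belonging to no subdomain (usually a null set), the value is \<open>c\<close> by convention; this
  keeps the bounds on the coefficient without any assumption on the measure of the interfaces.
\<close>

definition piecewise_scale ::
    "('l::finite \<Rightarrow> (real^3) set) \<Rightarrow> (real^3 \<Rightarrow> complex) \<Rightarrow> real^'l \<Rightarrow> real^3 \<Rightarrow> complex" where
  "piecewise_scale P c u x =
     (if \<exists>k. x \<in> P k then of_real (u $ (THE k. x \<in> P k)) * c x else c x)"

definition U_ad :: "real^'l::finite \<Rightarrow> real^'l \<Rightarrow> (real^'l) set" where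
  "U_ad a b = {v. \<forall>k. a $ k \<le> v $ k \<and> v $ k \<le> b $ k}"

definition state_equation ::
    "(real^3) set \<Rightarrow> ('l::finite \<Rightarrow> (real^3) set) \<Rightarrow> real \<Rightarrow> (real^3 \<Rightarrow> real) \<Rightarrow>
     (real^3 \<Rightarrow> complex) \<Rightarrow> field \<Rightarrow> field \<Rightarrow> real^'l \<Rightarrow> bool" where
  "state_equation \<Omega> P \<omega> \<mu> \<epsilon>\<sigma> f y u \<longleftrightarrow>
     (\<forall>w\<in>H0_curl \<Omega>.
        L2_inner \<Omega> (\<lambda>x. inverse (\<mu> x) *\<^sub>R curl \<Omega> y x) (curl \<Omega> w)
        - of_real (\<omega>\<^sup>2) * L2_inner \<Omega> (\<lambda>x. piecewise_scale P \<epsilon>\<sigma> u x *s y x) w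
        = L2_inner \<Omega> f w)"

definition cost ::
    "(real^3) set \<Rightarrow> real \<Rightarrow> field \<Rightarrow> field \<Rightarrow> field \<Rightarrow> real^'l::finite \<Rightarrow> real" where
  "cost \<Omega> \<alpha> y\<^sub>\<Omega> E\<^sub>\<Omega> y u =
     1/2 * (L2_norm \<Omega> (\<lambda>x. y x - y\<^sub>\<Omega> x))\<^sup>2
     + 1/2 * (L2_norm \<Omega> (\<lambda>x. curl \<Omega> y x - E\<^sub>\<Omega> x))\<^sup>2
     + \<alpha>/2 * (norm u)\<^sup>2"

end

theory Submission
  imports Defs "HOL-Library.Function_Algebras"
begin

text \<open>
  For a fixed control the state equation is uniquely solvable by Lax--Milgram: the conductivity makes
  the sesquilinear form coercive after multiplication by a suitable complex constant, with all
  constants uniform over the admissible controls. Subtracting the equations for two controls shows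
  that the state depends Lipschitz continuously on the control in the graph norm. Hence the reduced
  cost is a continuous function on the compact box of admissible controls and attains its minimum.
  Since the curl is only a chosen representative, linearity and closedness of the curl rest on the
  uniqueness of weak curls, i.e. on the fundamental lemma of the calculus of variations.
\<close>

subsection \<open>The Lax--Milgram theorem\<close>

text \<open>The zero-order term of the state equation has a negative real part, so the real part of
  the form is indefinite and Lax-Milgram does not apply to it directly. Its imaginary part, however,
  has one sign and stays away from zero uniformly, because the lower bounds of the controls are
  positive. Since \<open>\<mu>\<close> is real, a factor 1 + i t with t large enough turns this
  imaginary part into a dominating positive contribution and leaves the curl term as it is.

  Controls are vectors of finite dimension, so the box is compact in norm and strong continuity of
  the state suffices: no weak limit of a product of coefficient and state has to be identified.

  Inner products are real parts of Hermitian products; the complex equation is recovered by testing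
  with i w. Limits, fixed points and states are determined only up to seminorm zero, so the cost
  must be shown to be blind to that ambiguity. Membership in \<open>H0_curl\<close> survives limits
  because weak curl and vanishing trace are both identities between pairings with fixed square
  integrable fields.\<close>

text \<open>
  The form is only semidefinite, since fields are representatives of classes modulo null sets.
\<close>

locale semi_inner =
  fixes S :: "'v::real_vector set" and ip :: "'v \<Rightarrow> 'v \<Rightarrow> real"
  assumes subspace: "subspace S"
    and add_left: "\<And>x y z. x \<in> S \<Longrightarrow> y \<in> S \<Longrightarrow> z \<in> S \<Longrightarrow> ip (x + y) z = ip x z + ip y z"
    and scale_left: "\<And>x z r. x \<in> S \<Longrightarrow> z \<in> S \<Longrightarrow> ip (r *\<^sub>R x) z = r * ip x z"
    and commute: "\<And>x y. x \<in> S \<Longrightarrow> y \<in> S \<Longrightarrow> ip x y = ip y x"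
    and nonneg: "\<And>x. x \<in> S \<Longrightarrow> 0 \<le> ip x x"
begin

definition nrm :: "'v \<Rightarrow> real" where "nrm x = sqrt (ip x x)"

lemma mem_add: "x \<in> S \<Longrightarrow> y \<in> S \<Longrightarrow> x + y \<in> S"
  and mem_diff: "x \<in> S \<Longrightarrow> y \<in> S \<Longrightarrow> x - y \<in> S"
  and mem_scale: "x \<in> S \<Longrightarrow> r *\<^sub>R x \<in> S"
  and mem_0: "0 \<in> S"
  using subspace by (auto simp: subspace_add subspace_diff subspace_mul subspace_0)

lemmas mem = mem_add mem_diff mem_scale mem_0

lemma diff_left: "x \<in> S \<Longrightarrow> y \<in> S \<Longrightarrow> z \<in> S \<Longrightarrow> ip (x - y) z = ip x z - ip y z"
  using add_left[of x "(-1) *\<^sub>R y" z] scale_left[of y z "-1"] mem_scale[of y "-1"] by simp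

lemma add_right: "x \<in> S \<Longrightarrow> y \<in> S \<Longrightarrow> z \<in> S \<Longrightarrow> ip z (x + y) = ip z x + ip z y"
  by (metis add_left commute mem_add)

lemma diff_right: "x \<in> S \<Longrightarrow> y \<in> S \<Longrightarrow> z \<in> S \<Longrightarrow> ip z (x - y) = ip z x - ip z y"
  by (metis diff_left commute mem_diff)

lemma scale_right: "x \<in> S \<Longrightarrow> z \<in> S \<Longrightarrow> ip z (r *\<^sub>R x) = r * ip z x"
  by (metis scale_left commute mem_scale)

lemmas bilin = add_left diff_left scale_left add_right diff_right scale_right

lemma nrm_ge_0: "x \<in> S \<Longrightarrow> 0 \<le> nrm x"
  by (simp add: nrm_def nonneg)

lemma nrm_square: "x \<in> S \<Longrightarrow> (nrm x)\<^sup>2 = ip x x"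
  by (simp add: nrm_def nonneg)

text \<open>The quadratic \<open>ip (x + t y) (x + t y)\<close> in t is nonnegative. The degenerate
  case is separate, since \<open>ip y y = 0\<close> does not force \<open>y = 0\<close>.\<close>

lemma Cauchy_Schwarz:
  assumes x: "x \<in> S" and y: "y \<in> S"
  shows "\<bar>ip x y\<bar> \<le> nrm x * nrm y"
proof -
  have q: "0 \<le> ip x x + 2 * t * ip x y + t\<^sup>2 * ip y y" for t
  proof -
    have "0 \<le> ip (x + t *\<^sub>R y) (x + t *\<^sub>R y)"
      using x y by (intro nonneg mem)
    also have "\<dots> = ip x x + 2 * t * ip x y + t\<^sup>2 * ip y y"
      using x y commute[OF x y] by (simp add: bilin mem algebra_simps power2_eq_square)
    finally show ?thesis .
  qed
  have "(ip x y)\<^sup>2 \<le> ip x x * ip y y"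
  proof (cases "ip y y = 0")
    case True
    have "ip x y = 0"
    proof (rule ccontr)
      assume n: "ip x y \<noteq> 0"
      \<comment> \<open>With \<open>ip y y = 0\<close> the quadratic is affine in t, and this t
        gives it the value -1.\<close>
      have "0 \<le> ip x x + 2 * (- (ip x x + 1) / (2 * ip x y)) * ip x y"
        using q[of "- (ip x x + 1) / (2 * ip x y)"] True by simp
      then show False using n by (simp add: field_simps)
    qed
    then show ?thesis using True by simp
  next
    case False
    then have pos: "ip y y > 0" using nonneg[OF y] by simp
    show ?thesis
      using q[of "- ip x y / ip y y"] pos by (simp add: field_simps power2_eq_square)
  qed
  then show ?thesis
    unfolding nrm_def by (metis real_sqrt_abs real_sqrt_le_iff real_sqrt_mult)
qed

lemma nrm_triangle:
  assumes x: "x \<in> S" and y: "y \<in> S"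
  shows "nrm (x + y) \<le> nrm x + nrm y"
proof -
  have "(nrm (x + y))\<^sup>2 = ip x x + 2 * ip x y + ip y y"
    using x y commute[OF x y] by (simp add: nrm_square bilin mem)
  also have "\<dots> \<le> (nrm x + nrm y)\<^sup>2"
    using Cauchy_Schwarz[OF x y] x y by (simp add: power2_sum nrm_square)
  finally show ?thesis
    by (meson add_nonneg_nonneg nrm_ge_0 power2_le_imp_le x y)
qed

lemma nrm_diff_commute: "x \<in> S \<Longrightarrow> y \<in> S \<Longrightarrow> nrm (x - y) = nrm (y - x)"
  by (simp add: nrm_def bilin mem)

lemma nrm_diff_triangle:
  assumes "x \<in> S" "y \<in> S" "z \<in> S"
  shows "nrm (x - z) \<le> nrm (x - y) + nrm (y - z)"
  using nrm_triangle[of "x - y" "y - z"] assms by (simp add: mem)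

end

section \<open>Riesz representation, contractions and Lax-Milgram in a complete seminormed
  space\<close>

locale semi_hilbert = semi_inner +
  assumes complete: "\<And>X. (\<And>n. X n \<in> S) \<Longrightarrow>
      (\<And>e. e > 0 \<Longrightarrow> \<exists>N. \<forall>m\<ge>N. \<forall>n\<ge>N. ip (X m - X n) (X m - X n) < e) \<Longrightarrow>
      \<exists>l\<in>S. (\<lambda>n. ip (X n - l) (X n - l)) \<longlonglongrightarrow> 0"
begin

text \<open>Direct method: the representer is the limit of a minimizing sequence of
  \<open>ip z z - 2 * \<phi> z\<close>, whose Euler equation is
  \<open>ip z w = \<phi> w\<close>.\<close>

lemma Riesz_representation:
  fixes \<phi> :: "'a \<Rightarrow> real"
  assumes add: "\<And>x y. x \<in> S \<Longrightarrow> y \<in> S \<Longrightarrow> \<phi> (x + y) = \<phi> x + \<phi> y"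
    and scale: "\<And>x r. x \<in> S \<Longrightarrow> \<phi> (r *\<^sub>R x) = r * \<phi> x"
    and bound: "\<And>x. x \<in> S \<Longrightarrow> \<bar>\<phi> x\<bar> \<le> C * nrm x"
  shows "\<exists>z\<in>S. \<forall>w\<in>S. ip z w = \<phi> w"
proof -
  define J where "J z = ip z z - 2 * \<phi> z" for z
  define I where "I = Inf (J ` S)"
  have low: "- (C\<^sup>2) \<le> J z" if z: "z \<in> S" for z
  proof -
    have "0 \<le> (nrm z - C)\<^sup>2" by simp
    then show ?thesis
      using bound[OF z] z by (simp add: J_def power2_diff nrm_square abs_le_iff mult.commute)
  qed
  have bdd: "bdd_below (J ` S)" using low by (auto simp: bdd_below_def)
  have ge: "I \<le> J z" if "z \<in> S" for z
    unfolding I_def using that bdd by (intro cInf_lower) auto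
  have "\<exists>z\<in>S. J z < I + 1 / real (Suc n)" for n
  proof -
    have "\<exists>y\<in>J ` S. y < I + 1 / real (Suc n)"
      unfolding I_def using bdd mem_0 by (subst cInf_less_iff[symmetric]) auto
    then show ?thesis by auto
  qed
  then obtain X where X: "X n \<in> S" and JX: "J (X n) < I + 1 / real (Suc n)" for n
    by metis
  \<comment> \<open>Parallelogram identity: four times the value of \<open>J\<close> at the midpoint
    is \<open>2 * J (X m) + 2 * J (X n)\<close> minus the squared distance, and the midpoint cannot
    fall below the infimum.\<close>
  have par: "ip (X m - X n) (X m - X n) \<le> 2 / real (Suc m) + 2 / real (Suc n)" for m n
  proof -
    have "I \<le> J ((1/2) *\<^sub>R (X m + X n))" using X by (intro ge mem)
    then have "4 * I \<le> 2 * J (X m) + 2 * J (X n) - ip (X m - X n) (X m - X n)"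
      using X[of m] X[of n] commute[OF X[of m] X[of n]]
      by (simp add: J_def bilin mem add scale field_simps)
    then show ?thesis using JX[of m] JX[of n] by simp
  qed
  have "\<exists>N. \<forall>m\<ge>N. \<forall>n\<ge>N. ip (X m - X n) (X m - X n) < e" if e: "e > 0" for e
  proof -
    obtain N where N: "1 / real (Suc N) < e / 4"
      using e by (meson nat_approx_posE zero_less_divide_iff zero_less_numeral)
    have "ip (X m - X n) (X m - X n) < e" if "m \<ge> N" "n \<ge> N" for m n
    proof -
      have "1 / real (Suc m) \<le> 1 / real (Suc N)" "1 / real (Suc n) \<le> 1 / real (Suc N)"
        using that by (auto intro!: divide_left_mono)
      then show ?thesis using par[of m n] N by simp
    qed
    then show ?thesis by blast
  qed
  then obtain z where z: "z \<in> S" and lim: "(\<lambda>n. ip (X n - z) (X n - z)) \<longlonglongrightarrow> 0"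
    using complete X by blast
  have "ip z w = \<phi> w" if w: "w \<in> S" for w
  proof -
    have limw: "(\<lambda>n. ip (X n) w) \<longlonglongrightarrow> ip z w"
    proof (rule LIM_zero_cancel, rule Lim_null_comparison)
      show "\<forall>\<^sub>F n in sequentially. norm (ip (X n) w - ip z w) \<le> nrm (X n - z) * nrm w"
        using Cauchy_Schwarz[of "X _ - z" w] X z w by (simp add: mem bilin)
      show "(\<lambda>n. nrm (X n - z) * nrm w) \<longlonglongrightarrow> 0"
        unfolding nrm_def using tendsto_real_sqrt[OF lim] by (auto intro: tendsto_mult_left_zero)
    qed
    \<comment> \<open>The variation is taken at \<open>X n\<close>, not at \<open>z\<close>, so
      \<open>z\<close> need not be shown to minimize \<open>J\<close>; the slack
      \<open>1 / real (Suc n)\<close> disappears in the limit.\<close>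
    have q: "0 \<le> 2 * t * (ip z w - \<phi> w) + t\<^sup>2 * ip w w" for t
    proof -
      have "- (1 / real (Suc n)) \<le> 2 * t * (ip (X n) w - \<phi> w) + t\<^sup>2 * ip w w" for n
      proof -
        have "I \<le> J (X n + t *\<^sub>R w)" using X w by (intro ge mem)
        then show ?thesis
          using JX[of n] X[of n] w commute[OF X[of n] w]
          by (simp add: J_def bilin mem add scale algebra_simps power2_eq_square)
      qed
      moreover have "(\<lambda>n. - (1 / real (Suc n))) \<longlonglongrightarrow> 0"
        using tendsto_minus[OF LIMSEQ_inverse_real_of_nat] by (simp add: inverse_eq_divide)
      moreover have "(\<lambda>n. 2 * t * (ip (X n) w - \<phi> w) + t\<^sup>2 * ip w w)
          \<longlonglongrightarrow> 2 * t * (ip z w - \<phi> w) + t\<^sup>2 * ip w w"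
        by (intro tendsto_intros limw)
      ultimately show ?thesis by (intro LIMSEQ_le) auto
    qed
    define d where "d = ip z w - \<phi> w"
    \<comment> \<open>The quadratic is evaluated at \<open>t = - s * d\<close>. The summand 1 covers
      \<open>ip w w = 0\<close> and gives \<open>s * ip w w < 1\<close>, so the resulting factor
      \<open>s * ip w w - 2\<close> is negative and forces \<open>d = 0\<close>.\<close>
    define s where "s = 1 / (ip w w + 1)"
    have s: "s > 0" "s * ip w w < 1" using nonneg[OF w] by (auto simp: s_def)
    have "0 \<le> s * d\<^sup>2 * (s * ip w w - 2)"
      using q[of "- s * d"] unfolding d_def[symmetric] by (simp add: algebra_simps power2_eq_square)
    then have "s * d\<^sup>2 \<le> 0" using s by (simp add: zero_le_mult_iff)
    then have "d = 0" using s by (simp add: mult_le_0_iff)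
    then show ?thesis by (simp add: d_def)
  qed
  then show ?thesis using z by blast
qed

text \<open>Banach iteration in a seminorm: the limit is a fixed point only up to a vector of
  seminorm zero.\<close>

lemma contraction_fixpoint:
  assumes T: "\<And>x. x \<in> S \<Longrightarrow> T x \<in> S"
    and contr: "\<And>x y. x \<in> S \<Longrightarrow> y \<in> S \<Longrightarrow> nrm (T x - T y) \<le> r * nrm (x - y)"
    and r: "0 \<le> r" "r < 1"
  shows "\<exists>l\<in>S. nrm (T l - l) = 0"
proof -
  define X where "X n = (T ^^ n) 0" for n
  have X: "X n \<in> S" for n by (induction n) (auto simp: X_def mem T)
  have X_Suc: "X (Suc n) = T (X n)" for n by (simp add: X_def)
  \<comment> \<open>The sum of the geometric series of the step lengths. It reproduces itself as
    \<open>r * D + D * (1 - r) = D\<close>, which replaces summation in the induction for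
    \<open>bnd\<close>.\<close>
  define D where "D = nrm (X 1 - X 0) / (1 - r)"
  have D: "nrm (X 1 - X 0) = D * (1 - r)" "0 \<le> D" using r X by (auto simp: D_def nrm_ge_0 mem)
  have bnd: "nrm (X k - X 0) \<le> D" for k
  proof (induction k)
    case 0
    have "ip (X 0 - X 0) (X 0 - X 0) = 0"
      using diff_left[OF X X mem_diff[OF X X], of 0 0 0 0] by simp
    then have "nrm (X 0 - X 0) = 0" by (simp add: nrm_def)
    then show ?case using D by simp
  next
    case (Suc k)
    have "nrm (X (Suc k) - X 0) \<le> nrm (X (Suc k) - X 1) + nrm (X 1 - X 0)"
      by (intro nrm_diff_triangle X)
    also have "nrm (X (Suc k) - X 1) \<le> r * nrm (X k - X 0)"
      using contr[OF X[of k] X[of 0]] X_Suc[of 0] X_Suc[of k] by simp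
    also have "\<dots> \<le> r * D" using Suc r by (intro mult_left_mono)
    finally show ?case using D by (simp add: algebra_simps)
  qed
  have geo: "nrm (X (n + k) - X n) \<le> r ^ n * D" for n k
  proof (induction n)
    case 0
    then show ?case using bnd by simp
  next
    case (Suc n)
    have "nrm (X (Suc n + k) - X (Suc n)) \<le> r * nrm (X (n + k) - X n)"
      using contr[OF X X] X_Suc by simp
    also have "\<dots> \<le> r * (r ^ n * D)" using Suc r by (intro mult_left_mono)
    finally show ?case by (simp add: mult.assoc)
  qed
  have lim0: "(\<lambda>n. r ^ n * D) \<longlonglongrightarrow> 0"
    using r by (auto intro!: tendsto_mult_left_zero LIMSEQ_power_zero)
  have "\<exists>N. \<forall>m\<ge>N. \<forall>n\<ge>N. ip (X m - X n) (X m - X n) < e" if e: "e > 0" for e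
  proof -
    have "\<forall>\<^sub>F n in sequentially. r ^ n * D < sqrt e"
      using order_tendstoD(2)[OF lim0, of "sqrt e"] e by simp
    then obtain N where N: "\<And>n. n \<ge> N \<Longrightarrow> r ^ n * D < sqrt e"
      by (auto simp: eventually_sequentially)
    have main: "nrm (X m - X n) < sqrt e" if "m \<ge> n" "n \<ge> N" for m n
      using geo[of n "m - n"] N[OF that(2)] that by simp
    have "nrm (X m - X n) < sqrt e" if "m \<ge> N" "n \<ge> N" for m n
      using main[of m n] main[of n m] that nrm_diff_commute[OF X X, of m n] by linarith
    then show ?thesis by (auto simp: nrm_def)
  qed
  then obtain l where l: "l \<in> S" and lim: "(\<lambda>n. ip (X n - l) (X n - l)) \<longlonglongrightarrow> 0"
    using complete X by blast
  have lim': "(\<lambda>n. nrm (X n - l)) \<longlonglongrightarrow> 0"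
    unfolding nrm_def using tendsto_real_sqrt[OF lim] by simp
  have "nrm (T l - l) \<le> r * nrm (X n - l) + nrm (X (Suc n) - l)" for n
    using nrm_diff_triangle[of "T l" "X (Suc n)" l] contr[OF l X[of n]] T l X
      nrm_diff_commute[OF l X[of n]]
    by (simp add: X_Suc)
  moreover have "(\<lambda>n. r * nrm (X n - l) + nrm (X (Suc n) - l)) \<longlonglongrightarrow> r * 0 + 0"
    by (intro tendsto_intros lim' LIMSEQ_Suc)
  ultimately have "nrm (T l - l) \<le> 0" by (intro LIMSEQ_le_const[of _ "r * 0 + 0", simplified]) auto
  moreover have "0 \<le> nrm (T l - l)" using T l by (intro nrm_ge_0 mem)
  ultimately show ?thesis using l by force
qed

text \<open>Riesz turns \<open>b\<close> into an operator \<open>A\<close> and \<open>F\<close> into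
  a vector \<open>g\<close>; the equation \<open>A y = g\<close> is solved by iterating the damped
  residual step \<open>x - \<rho> (A x - g)\<close>.\<close>

theorem Lax_Milgram:
  fixes b :: "'a \<Rightarrow> 'a \<Rightarrow> real"
  assumes b_add_left: "\<And>x y z. x \<in> S \<Longrightarrow> y \<in> S \<Longrightarrow> z \<in> S \<Longrightarrow> b (x + y) z = b x z + b y z"
    and b_scale_left: "\<And>x z r. x \<in> S \<Longrightarrow> z \<in> S \<Longrightarrow> b (r *\<^sub>R x) z = r * b x z"
    and b_add_right: "\<And>x y z. x \<in> S \<Longrightarrow> y \<in> S \<Longrightarrow> z \<in> S \<Longrightarrow> b z (x + y) = b z x + b z y"
    and b_scale_right: "\<And>x z r. x \<in> S \<Longrightarrow> z \<in> S \<Longrightarrow> b z (r *\<^sub>R x) = r * b z x"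
    and b_bound: "\<And>x y. x \<in> S \<Longrightarrow> y \<in> S \<Longrightarrow> \<bar>b x y\<bar> \<le> C * nrm x * nrm y"
    and coercive: "\<And>x. x \<in> S \<Longrightarrow> c * ip x x \<le> b x x" "c > 0"
    and F_add: "\<And>x y. x \<in> S \<Longrightarrow> y \<in> S \<Longrightarrow> F (x + y) = F x + F y"
    and F_scale: "\<And>x r. x \<in> S \<Longrightarrow> F (r *\<^sub>R x) = r * F x"
    and F_bound: "\<And>x. x \<in> S \<Longrightarrow> \<bar>F x\<bar> \<le> D * nrm x"
  shows "\<exists>y\<in>S. \<forall>w\<in>S. b y w = F w"
proof -
  have "\<forall>x\<in>S. \<exists>z\<in>S. \<forall>w\<in>S. ip z w = b x w"
  proof
    fix x assume x: "x \<in> S"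
    show "\<exists>z\<in>S. \<forall>w\<in>S. ip z w = b x w"
      by (rule Riesz_representation[where C = "C * nrm x"])
        (use x b_add_right b_scale_right b_bound in auto)
  qed
  then obtain A where A: "\<And>x. x \<in> S \<Longrightarrow> A x \<in> S" "\<And>x w. x \<in> S \<Longrightarrow> w \<in> S \<Longrightarrow> ip (A x) w = b x w"
    by metis
  obtain g where g: "g \<in> S" "\<And>w. w \<in> S \<Longrightarrow> ip g w = F w"
    using Riesz_representation[of F D] F_add F_scale F_bound by blast
  \<comment> \<open>\<open>C\<close> may be smaller than \<open>c\<close>, even nonpositive, when
    the seminorm vanishes on \<open>S\<close>. The maximum keeps \<open>K\<close> positive and
    \<open>c\<^sup>2 / K\<^sup>2\<close> at most 1.\<close>
  define K where "K = max C c"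
  have K: "K > 0" "C \<le> K" "c \<le> K" using coercive(2) by (auto simp: K_def)
  \<comment> \<open>This damping minimizes
    \<open>1 - 2 * \<rho> * c + \<rho>\<^sup>2 * K\<^sup>2\<close>, the bound on the squared
    contraction factor; the minimum is \<open>k\<close> below.\<close>
  define \<rho> where "\<rho> = c / K\<^sup>2"
  have \<rho>: "\<rho> > 0" using K coercive(2) by (simp add: \<rho>_def)
  define T where "T x = x - \<rho> *\<^sub>R (A x - g)" for x
  define k where "k = 1 - c\<^sup>2 / K\<^sup>2"
  have k: "0 \<le> k" "k < 1"
    using K coercive(2) by (auto simp: k_def power_mono)
  have T: "T x \<in> S" if "x \<in> S" for x using that A g by (auto simp: T_def intro!: mem)
  have contr: "nrm (T x - T y) \<le> sqrt k * nrm (x - y)" if x: "x \<in> S" and y: "y \<in> S" for x y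
  proof -
    define d where "d = x - y"
    define e where "e = A x - A y"
    have d: "d \<in> S" and e: "e \<in> S" using x y A by (auto simp: d_def e_def intro!: mem)
    have b_diff: "b (x - y) w = b x w - b y w" if "w \<in> S" for w
      using b_add_left[of x "(-1) *\<^sub>R y" w] b_scale_left[of y w "-1"] mem_scale[of y "-1"] x y that
      by simp
    have ipe: "ip e w = b d w" if "w \<in> S" for w
      using that x y A by (simp add: e_def d_def bilin b_diff)
    have "(nrm e)\<^sup>2 \<le> K * nrm d * nrm e"
    proof -
      have "(nrm e)\<^sup>2 = b d e" using e by (simp add: nrm_square ipe)
      also have "\<dots> \<le> C * nrm d * nrm e" using b_bound[OF d e] by linarith
      also have "\<dots> \<le> K * nrm d * nrm e" using K d e by (intro mult_right_mono nrm_ge_0) auto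
      finally show ?thesis .
    qed
    then have le: "nrm e \<le> K * nrm d"
      using nrm_ge_0[OF e] nrm_ge_0[OF d] K
      by (cases "nrm e = 0") (auto simp: power2_eq_square)
    have "T x - T y = d - \<rho> *\<^sub>R e"
      by (simp add: T_def d_def e_def algebra_simps)
    then have "(nrm (T x - T y))\<^sup>2 = ip (d - \<rho> *\<^sub>R e) (d - \<rho> *\<^sub>R e)"
      using d e by (simp add: nrm_square mem)
    also have "\<dots> = ip d d - 2 * \<rho> * ip e d + \<rho>\<^sup>2 * ip e e"
      using d e commute[OF d e] by (simp add: bilin mem algebra_simps power2_eq_square)
    also have "\<dots> \<le> ip d d - 2 * \<rho> * (c * ip d d) + \<rho>\<^sup>2 * (K\<^sup>2 * ip d d)"
    proof -
      have "ip e e \<le> K\<^sup>2 * ip d d"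
        using power_mono[OF le nrm_ge_0[OF e], of 2] d e by (simp add: nrm_square power_mult_distrib)
      then have "\<rho>\<^sup>2 * ip e e \<le> \<rho>\<^sup>2 * (K\<^sup>2 * ip d d)" by (intro mult_left_mono) auto
      moreover have "\<rho> * (c * ip d d) \<le> \<rho> * ip e d"
        using coercive(1)[OF d] \<rho> ipe[OF d] by (intro mult_left_mono) auto
      ultimately show ?thesis by linarith
    qed
    also have "\<dots> = k * ip d d"
      using K by (simp add: k_def \<rho>_def field_simps power2_eq_square)
    also have "\<dots> = (sqrt k * nrm d)\<^sup>2" using k d by (simp add: power_mult_distrib nrm_square)
    finally show ?thesis
      unfolding d_def by (rule power2_le_imp_le) (use k x y in \<open>simp add: nrm_ge_0 mem\<close>)
  qed
  obtain y where y: "y \<in> S" "nrm (T y - y) = 0"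
    using contraction_fixpoint[of T "sqrt k"] T contr k by auto
  have "b y w = F w" if w: "w \<in> S" for w
  proof -
    \<comment> \<open>\<open>T y\<close> and \<open>y\<close> may differ, but a vector of seminorm
      zero pairs to zero with everything, which is all that the equation requires.\<close>
    have "\<bar>ip (T y - y) w\<bar> \<le> 0"
      using Cauchy_Schwarz[of "T y - y" w] y w T by (simp add: mem)
    moreover have "ip (T y - y) w = - \<rho> * (b y w - F w)"
      using y w A g diff_left[of y "\<rho> *\<^sub>R (A y - g)" w] diff_left[of "y - \<rho> *\<^sub>R (A y - g)" y w]
      by (simp add: T_def bilin(2,3) mem del: diff_diff_eq2 diff_add_cancel)
    ultimately show ?thesis using \<rho> by simp
  qed
  then show ?thesis using y by blast
qed

end

subsection \<open>Square integrable fields\<close>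

text \<open>Together with pointwise addition this makes fields a real vector space, to which the
  abstract locales apply.\<close>

instantiation "fun" :: (type, scaleR) scaleR
begin
definition "r *\<^sub>R f = (\<lambda>x. r *\<^sub>R f x)"
instance ..
end

lemma scaleR_fun_apply [simp]: "(r *\<^sub>R f) x = r *\<^sub>R f x"
  by (simp add: scaleR_fun_def)

instance "fun" :: (type, real_vector) real_vector
  by standard (auto simp: fun_eq_iff algebra_simps)

section \<open>The Hermitian product on C^3 as integrand of \<open>L2_inner\<close>\<close>

definition herm :: "complex^3 \<Rightarrow> complex^3 \<Rightarrow> complex" where
  "herm v w = (\<Sum>i\<in>UNIV. v $ i * cnj (w $ i))"

lemma herm_add_left: "herm (u + v) w = herm u w + herm v w"
  and herm_add_right: "herm w (u + v) = herm w u + herm w v"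
  and herm_smult_left: "herm (c *s v) w = c * herm v w"
  and herm_smult_right: "herm v (c *s w) = cnj c * herm v w"
  and herm_commute: "herm v w = cnj (herm w v)"
  by (simp_all add: herm_def algebra_simps sum.distrib sum_distrib_left)

lemma norm_smult_vec: "norm (c *s (v :: complex^3)) = norm c * norm v"
  by (simp add: norm_vec_def L2_set_def norm_mult power_mult_distrib sum_distrib_left[symmetric] real_sqrt_mult)

lemma herm_self: "herm v v = of_real ((norm v)\<^sup>2)"
  by (simp add: herm_def norm_vec_def L2_set_def sum_nonneg complex_norm_square del: of_real_power)

lemma norm_herm_le: "norm (herm v w) \<le> norm v * norm w"
proof -
  have "norm (herm v w) \<le> (\<Sum>i\<in>UNIV. \<bar>norm (v $ i)\<bar> * \<bar>norm (w $ i)\<bar>)"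
    unfolding herm_def by (rule order_trans[OF norm_sum]) (simp add: norm_mult)
  also have "\<dots> \<le> norm v * norm w"
    unfolding norm_vec_def by (rule L2_set_mult_ineq)
  finally show ?thesis .
qed

lemma borel_measurable_herm [measurable]:
  assumes [measurable]: "v \<in> borel_measurable M" "w \<in> borel_measurable M"
  shows "(\<lambda>x. herm (v x) (w x)) \<in> borel_measurable M"
proof (rule borel_measurable_continuous_Pair[OF assms])
  show "continuous_on UNIV (\<lambda>x. herm (fst x) (snd x))"
    unfolding herm_def by (intro continuous_intros)
qed

lemma borel_measurable_smult_vec [measurable]:
  fixes v :: "'a \<Rightarrow> complex^3"
  assumes [measurable]: "c \<in> borel_measurable M" "v \<in> borel_measurable M"
  shows "(\<lambda>x. c x *s v x) \<in> borel_measurable M"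
proof (rule borel_measurable_continuous_Pair[OF assms])
  show "continuous_on UNIV (\<lambda>x. fst x *s snd x :: complex^3)"
    unfolding vector_scalar_mult_def by (intro continuous_intros)
qed

lemma L2_measurable: "v \<in> L2 \<Omega> \<Longrightarrow> v \<in> borel_measurable (lebesgue_on \<Omega>)"
  and L2_integrable: "v \<in> L2 \<Omega> \<Longrightarrow> integrable (lebesgue_on \<Omega>) (\<lambda>x. (norm (v x))\<^sup>2)"
  by (auto simp: L2_def)

lemma L2_mult_bounded:
  assumes v: "v \<in> L2 \<Omega>" and g: "g \<in> borel_measurable (lebesgue_on \<Omega>)"
    and bound: "AE x in lebesgue_on \<Omega>. norm (g x) \<le> C"
  shows "(\<lambda>x. g x *s v x) \<in> L2 \<Omega>"
proof -
  note [measurable] = L2_measurable[OF v] g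
  have "integrable (lebesgue_on \<Omega>) (\<lambda>x. (norm (g x *s v x))\<^sup>2)"
  proof (rule Bochner_Integration.integrable_bound)
    show "integrable (lebesgue_on \<Omega>) (\<lambda>x. C\<^sup>2 * (norm (v x))\<^sup>2)"
      using L2_integrable[OF v] by simp
    show "AE x in lebesgue_on \<Omega>. norm ((norm (g x *s v x))\<^sup>2) \<le> norm (C\<^sup>2 * (norm (v x))\<^sup>2)"
      using bound by eventually_elim
        (auto simp: norm_smult_vec power_mult_distrib intro!: mult_right_mono power_mono)
  qed measurable
  then show ?thesis by (simp add: L2_def)
qed

lemma L2_smult: "v \<in> L2 \<Omega> \<Longrightarrow> (\<lambda>x. c *s v x) \<in> L2 \<Omega>"
  by (rule L2_mult_bounded[where C = "norm c"]) auto

lemma subspace_L2: "subspace (L2 \<Omega>)"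
proof (rule subspaceI)
  show "0 \<in> L2 \<Omega>" by (simp add: L2_def zero_fun_def)
next
  fix v w assume v: "v \<in> L2 \<Omega>" and w: "w \<in> L2 \<Omega>"
  note [measurable] = L2_measurable[OF v] L2_measurable[OF w]
  have "integrable (lebesgue_on \<Omega>) (\<lambda>x. (norm (v x + w x))\<^sup>2)"
  proof (rule Bochner_Integration.integrable_bound)
    show "integrable (lebesgue_on \<Omega>) (\<lambda>x. 2 * (norm (v x))\<^sup>2 + 2 * (norm (w x))\<^sup>2)"
      using L2_integrable[OF v] L2_integrable[OF w] by simp
    have "(norm (v x + w x))\<^sup>2 \<le> 2 * (norm (v x))\<^sup>2 + 2 * (norm (w x))\<^sup>2" for x
    proof -
      have "(norm (v x + w x))\<^sup>2 \<le> (norm (v x) + norm (w x))\<^sup>2"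
        by (intro power_mono norm_triangle_ineq) auto
      also have "\<dots> \<le> 2 * (norm (v x))\<^sup>2 + 2 * (norm (w x))\<^sup>2"
        using sum_squares_bound[of "norm (v x)" "norm (w x)"] by (simp add: power2_sum)
      finally show ?thesis .
    qed
    then show "AE x in lebesgue_on \<Omega>. norm ((norm (v x + w x))\<^sup>2)
        \<le> norm (2 * (norm (v x))\<^sup>2 + 2 * (norm (w x))\<^sup>2)"
      by simp
  qed measurable
  then show "v + w \<in> L2 \<Omega>" by (simp add: L2_def plus_fun_def)
next
  fix r v assume v: "v \<in> L2 \<Omega>"
  show "r *\<^sub>R v \<in> L2 \<Omega>"
    using v by (auto simp: L2_def scaleR_fun_def power_mult_distrib)
qed

lemma L2_add: "v \<in> L2 \<Omega> \<Longrightarrow> w \<in> L2 \<Omega> \<Longrightarrow> v + w \<in> L2 \<Omega>"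
  and L2_diff: "v \<in> L2 \<Omega> \<Longrightarrow> w \<in> L2 \<Omega> \<Longrightarrow> v - w \<in> L2 \<Omega>"
  and L2_zero: "0 \<in> L2 \<Omega>"
  using subspace_L2 by (auto simp: subspace_add subspace_diff subspace_0)

lemma L2_inner_herm: "L2_inner \<Omega> v w = (LINT x|lebesgue_on \<Omega>. herm (v x) (w x))"
  by (simp add: L2_inner_def herm_def)

lemma integrable_herm:
  assumes v: "v \<in> L2 \<Omega>" and w: "w \<in> L2 \<Omega>"
  shows "integrable (lebesgue_on \<Omega>) (\<lambda>x. herm (v x) (w x))"
proof (rule Bochner_Integration.integrable_bound)
  note [measurable] = L2_measurable[OF v] L2_measurable[OF w]
  show "(\<lambda>x. herm (v x) (w x)) \<in> borel_measurable (lebesgue_on \<Omega>)" by measurable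
  show "integrable (lebesgue_on \<Omega>) (\<lambda>x. (norm (v x))\<^sup>2 + (norm (w x))\<^sup>2)"
    using L2_integrable[OF v] L2_integrable[OF w] by simp
  have "norm (herm (v x) (w x)) \<le> (norm (v x))\<^sup>2 + (norm (w x))\<^sup>2" for x
    using norm_herm_le[of "v x" "w x"] sum_squares_bound[of "norm (v x)" "norm (w x)"]
      mult_nonneg_nonneg[of "norm (v x)" "norm (w x)"]
    unfolding mult.assoc[of 2] by (smt (verit) norm_ge_zero)
  then show "AE x in lebesgue_on \<Omega>. norm (herm (v x) (w x)) \<le> norm ((norm (v x))\<^sup>2 + (norm (w x))\<^sup>2)"
    by simp
qed

lemma L2_inner_add_left:
  "u \<in> L2 \<Omega> \<Longrightarrow> v \<in> L2 \<Omega> \<Longrightarrow> w \<in> L2 \<Omega> \<Longrightarrow> L2_inner \<Omega> (u + v) w = L2_inner \<Omega> u w + L2_inner \<Omega> v w"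
  and L2_inner_add_right:
  "u \<in> L2 \<Omega> \<Longrightarrow> v \<in> L2 \<Omega> \<Longrightarrow> w \<in> L2 \<Omega> \<Longrightarrow> L2_inner \<Omega> w (u + v) = L2_inner \<Omega> w u + L2_inner \<Omega> w v"
  by (simp_all add: L2_inner_herm herm_add_left herm_add_right integrable_herm)

lemma L2_inner_commute: "L2_inner \<Omega> v w = cnj (L2_inner \<Omega> w v)"
  unfolding L2_inner_herm by (subst Bochner_Integration.integral_cnj[symmetric]) (simp add: herm_commute[symmetric])

lemma L2_inner_smult_left: "L2_inner \<Omega> (\<lambda>x. c *s v x) w = c * L2_inner \<Omega> v w"
  and L2_inner_smult_right: "L2_inner \<Omega> v (\<lambda>x. c *s w x) = cnj c * L2_inner \<Omega> v w"
  by (simp_all add: L2_inner_herm herm_smult_left herm_smult_right)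

lemma scaleR_eq_smult: "r *\<^sub>R (v :: field) = (\<lambda>x. complex_of_real r *s v x)"
  by (simp add: fun_eq_iff vec_eq_iff scaleR_conv_of_real[where 'a = complex])

lemma L2_inner_scaleR_left: "L2_inner \<Omega> (r *\<^sub>R v) w = of_real r * L2_inner \<Omega> v w"
  and L2_inner_scaleR_right: "L2_inner \<Omega> v (r *\<^sub>R w) = of_real r * L2_inner \<Omega> v w"
  by (simp_all add: scaleR_eq_smult L2_inner_smult_left L2_inner_smult_right)

lemma L2_inner_diff_left:
  assumes "u \<in> L2 \<Omega>" "v \<in> L2 \<Omega>" "w \<in> L2 \<Omega>"
  shows "L2_inner \<Omega> (u - v) w = L2_inner \<Omega> u w - L2_inner \<Omega> v w"
  using L2_inner_add_left[of "u - v" \<Omega> v w] assms by (simp add: L2_diff)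

lemma L2_inner_cong_AE:
  assumes "v \<in> L2 \<Omega>" "v' \<in> L2 \<Omega>" "w \<in> L2 \<Omega>" "w' \<in> L2 \<Omega>"
    and "AE x in lebesgue_on \<Omega>. v x = v' x" "AE x in lebesgue_on \<Omega>. w x = w' x"
  shows "L2_inner \<Omega> v w = L2_inner \<Omega> v' w'"
  unfolding L2_inner_herm
  by (rule integral_cong_AE) (use assms in \<open>auto intro!: borel_measurable_herm L2_measurable\<close>)

lemma L2_norm_cong_AE:
  assumes "v \<in> L2 \<Omega>" "v' \<in> L2 \<Omega>" "AE x in lebesgue_on \<Omega>. v x = v' x"
  shows "L2_norm \<Omega> v = L2_norm \<Omega> v'"
  unfolding L2_norm_def
  by (intro arg_cong[of _ _ sqrt] integral_cong_AE) (use assms in \<open>auto dest: L2_measurable\<close>)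

lemma L2_inner_self: "L2_inner \<Omega> v v = of_real ((L2_norm \<Omega> v)\<^sup>2)"
  by (simp add: L2_inner_herm L2_norm_def herm_self integral_nonneg_AE del: of_real_power)

text \<open>Passing to the real part loses nothing in the norm, because
  \<open>L2_inner \<Omega> v v\<close> is real.\<close>

interpretation L2: semi_inner "L2 \<Omega>" "\<lambda>v w. Re (L2_inner \<Omega> v w)" for \<Omega>
proof
  show "Re (L2_inner \<Omega> v w) = Re (L2_inner \<Omega> w v)" for v w
    by (subst L2_inner_commute) simp
qed (auto simp: subspace_L2 L2_inner_add_left L2_inner_scaleR_left L2_inner_self)

lemma L2_nrm: "L2.nrm \<Omega> v = L2_norm \<Omega> v"
  by (simp add: L2.nrm_def L2_inner_self, simp add: L2_norm_def integral_nonneg_AE)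

lemmas L2_norm_diff_commute = L2.nrm_diff_commute[unfolded L2_nrm]

lemma L2_norm_nonneg [simp]: "0 \<le> L2_norm \<Omega> v"
  by (simp add: L2_norm_def integral_nonneg_AE)

lemma L2_norm_smult: "L2_norm \<Omega> (\<lambda>x. c *s v x) = norm c * L2_norm \<Omega> v"
  by (simp add: L2_norm_def norm_smult_vec power_mult_distrib real_sqrt_mult)

text \<open>Multiplying \<open>v\<close> by the unimodular number \<open>cnj (sgn z)\<close> makes
  the pairing real and nonnegative without changing the norm, so the real inequality gives the
  complex one.\<close>

lemma L2_Cauchy_Schwarz:
  assumes v: "v \<in> L2 \<Omega>" and w: "w \<in> L2 \<Omega>"
  shows "norm (L2_inner \<Omega> v w) \<le> L2_norm \<Omega> v * L2_norm \<Omega> w"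
proof (cases "L2_inner \<Omega> v w = 0")
  case False
  define z where "z = L2_inner \<Omega> v w"
  have "cnj (sgn z) * z = of_real (norm z)"
    using False complex_norm_square[of z]
    by (simp add: z_def[symmetric] sgn_eq divide_simps power2_eq_square mult.commute[of "cnj z"])
  then have "norm z = Re (cnj (sgn z) * z)" by simp
  also have "\<dots> = Re (L2_inner \<Omega> (\<lambda>x. cnj (sgn z) *s v x) w)"
    by (simp only: L2_inner_smult_left z_def)
  also have "\<dots> \<le> L2_norm \<Omega> (\<lambda>x. cnj (sgn z) *s v x) * L2_norm \<Omega> w"
    using L2.Cauchy_Schwarz[OF L2_smult[OF v] w, of "cnj (sgn z)"] unfolding L2_nrm by linarith
  also have "\<dots> = L2_norm \<Omega> v * L2_norm \<Omega> w"
    using False by (simp add: L2_norm_smult norm_sgn z_def)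
  finally show ?thesis by (simp add: z_def)
qed simp

lemma L2_norm_mult_bounded:
  assumes v: "v \<in> L2 \<Omega>" and g: "g \<in> borel_measurable (lebesgue_on \<Omega>)"
    and bound: "AE x in lebesgue_on \<Omega>. norm (g x) \<le> C" and C: "C \<ge> 0"
  shows "L2_norm \<Omega> (\<lambda>x. g x *s v x) \<le> C * L2_norm \<Omega> v"
proof -
  have "(LINT x|lebesgue_on \<Omega>. (norm (g x *s v x))\<^sup>2) \<le> (LINT x|lebesgue_on \<Omega>. C\<^sup>2 * (norm (v x))\<^sup>2)"
  proof (rule integral_mono_AE)
    show "AE x in lebesgue_on \<Omega>. (norm (g x *s v x))\<^sup>2 \<le> C\<^sup>2 * (norm (v x))\<^sup>2"
      using bound by eventually_elim
        (auto simp: norm_smult_vec power_mult_distrib intro!: mult_right_mono power_mono)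
  qed (use L2_integrable[OF L2_mult_bounded[OF v g bound]] L2_integrable[OF v] in auto)
  then have "L2_norm \<Omega> (\<lambda>x. g x *s v x) \<le> sqrt (C\<^sup>2 * (LINT x|lebesgue_on \<Omega>. (norm (v x))\<^sup>2))"
    unfolding L2_norm_def by simp
  then show ?thesis using C by (simp add: real_sqrt_mult L2_norm_def)
qed

lemma nn_integral_L2_norm:
  "v \<in> L2 \<Omega> \<Longrightarrow> (\<integral>\<^sup>+x. ennreal ((norm (v x))\<^sup>2) \<partial>lebesgue_on \<Omega>) = ennreal ((L2_norm \<Omega> v)\<^sup>2)"
  by (subst nn_integral_eq_integral) (auto simp: L2_integrable L2_norm_def integral_nonneg_AE)

text \<open>Fatou's lemma along an almost everywhere convergent subsequence.\<close>

lemma L2_complete: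
  fixes X :: "nat \<Rightarrow> field"
  assumes \<Omega>: "\<Omega> \<in> lmeasurable"
    and X: "\<And>n. X n \<in> L2 \<Omega>"
    and Cauchy: "\<And>e. e > 0 \<Longrightarrow> \<exists>N. \<forall>m\<ge>N. \<forall>n\<ge>N. L2_norm \<Omega> (X m - X n) < e"
  shows "\<exists>l\<in>L2 \<Omega>. (\<lambda>n. L2_norm \<Omega> (X n - l)) \<longlonglongrightarrow> 0"
proof -
  let ?M = "lebesgue_on \<Omega>"
  have fin: "finite_measure ?M" using \<Omega> by (simp add: finite_measure_lebesgue_on)
  interpret finite_measure ?M by fact
  note [measurable] = L2_measurable[OF X]
  have int_const: "integrable ?M (\<lambda>x. c::real)" for c by simp
  \<comment> \<open>Young's inequality with a free parameter: on a set of finite measure it turns a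
    Cauchy sequence in L2 into one in L1, for which almost everywhere Cauchy subsequences are
    available.\<close>
  have le: "norm z \<le> t * (norm z)\<^sup>2 + 1 / t" if "t > 0" for t and z :: "complex^3"
  proof -
    have "0 \<le> (t * norm z - 1)\<^sup>2" by simp
    then have "2 * norm z * t \<le> t\<^sup>2 * (norm z)\<^sup>2 + 1" by (simp add: power2_diff power_mult_distrib algebra_simps)
    moreover have "norm z * t \<le> 2 * norm z * t" using that by simp
    ultimately have "norm z * t \<le> t\<^sup>2 * (norm z)\<^sup>2 + 1" by linarith
    then show ?thesis using that by (simp add: field_simps power2_eq_square)
  qed
  have L1: "integrable ?M v" if v: "v \<in> L2 \<Omega>" for v
  proof (rule Bochner_Integration.integrable_bound)
    show "integrable ?M (\<lambda>x. 1 * (norm (v x))\<^sup>2 + 1 / 1)" using L2_integrable[OF v] by simp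
    show "AE x in ?M. norm (v x) \<le> norm (1 * (norm (v x))\<^sup>2 + 1 / 1)" using le[of 1] by auto
  qed (use v in \<open>simp add: L2_measurable\<close>)
  have L1_le: "(LINT x|?M. norm (v x)) \<le> t * (L2_norm \<Omega> v)\<^sup>2 + measure ?M (space ?M) / t"
    if v: "v \<in> L2 \<Omega>" and t: "t > 0" for v t
  proof -
    have "(LINT x|?M. norm (v x)) \<le> (LINT x|?M. t * (norm (v x))\<^sup>2 + 1 / t)"
      using L2_integrable[OF v] L1[OF v] le[OF t] by (intro integral_mono) auto
    also have "\<dots> = t * (L2_norm \<Omega> v)\<^sup>2 + measure ?M (space ?M) / t"
      using L2_integrable[OF v] by (simp add: L2_norm_def integral_nonneg_AE)
    finally show ?thesis .
  qed
  obtain r where r: "strict_mono r" and AE_Cauchy: "AE x in ?M. Cauchy (\<lambda>i. X (r i) x)"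
  proof (rule cauchy_L1_AE_cauchy_subseq[of ?M X])
    show "integrable ?M (X n)" for n using L1 X by blast
    fix e :: real assume e: "e > 0"
    define m where "m = measure ?M (space ?M)"
    \<comment> \<open>\<open>t\<close> is so large that the measure term is below
      \<open>e / 2\<close>, with \<open>m + 1\<close> covering measure zero. The threshold
      \<open>sqrt (e / (2 * t))\<close> then puts the quadratic term below \<open>e / 2\<close> as
      well.\<close>
    define t where "t = 2 * (m + 1) / e"
    have m: "m \<ge> 0" by (simp add: m_def)
    have t: "t > 0" using e m by (simp add: t_def)
    have mt: "m / t < e / 2" using e m by (simp add: t_def field_simps)
    obtain N where N: "\<And>i j. i \<ge> N \<Longrightarrow> j \<ge> N \<Longrightarrow> L2_norm \<Omega> (X i - X j) < sqrt (e / (2 * t))"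
      using Cauchy[of "sqrt (e / (2 * t))"] e t by auto
    have "(LINT x|?M. norm (X i x - X j x)) < e" if "i \<ge> N" "j \<ge> N" for i j
    proof -
      have "(L2_norm \<Omega> (X i - X j))\<^sup>2 < (sqrt (e / (2 * t)))\<^sup>2"
        using N[OF that] by (intro power_strict_mono) auto
      then have "t * (L2_norm \<Omega> (X i - X j))\<^sup>2 < e / 2"
        using e t by (simp add: field_simps)
      then show ?thesis
        using L1_le[OF L2_diff[OF X X] t, of i j] mt unfolding m_def minus_apply by linarith
    qed
    then show "\<exists>N. \<forall>i\<ge>N. \<forall>j\<ge>N. (LINT x|?M. norm (X i x - X j x)) < e" by blast
  qed
  define l where "l x = lim (\<lambda>i. X (r i) x)" for x
  have [measurable]: "l \<in> borel_measurable ?M"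
    unfolding l_def by (rule borel_measurable_lim_metric) simp
  have AE_lim: "AE x in ?M. (\<lambda>i. X (r i) x) \<longlonglongrightarrow> l x"
    using AE_Cauchy by eventually_elim (simp add: l_def Cauchy_convergent_iff convergent_LIMSEQ_iff)
  have bound: "(\<integral>\<^sup>+x. ennreal ((norm (X n x - l x))\<^sup>2) \<partial>?M) \<le> ennreal (e\<^sup>2)"
    if e: "e > 0" and N: "\<And>m. m \<ge> N \<Longrightarrow> L2_norm \<Omega> (X n - X m) < e" for n e N
  proof -
    have "(\<integral>\<^sup>+x. ennreal ((norm (X n x - l x))\<^sup>2) \<partial>?M)
        = (\<integral>\<^sup>+x. liminf (\<lambda>i. ennreal ((norm (X n x - X (r i) x))\<^sup>2)) \<partial>?M)"
    proof (rule nn_integral_cong_AE, use AE_lim in eventually_elim)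
      fix x assume "(\<lambda>i. X (r i) x) \<longlonglongrightarrow> l x"
      then have "(\<lambda>i. ennreal ((norm (X n x - X (r i) x))\<^sup>2)) \<longlonglongrightarrow> ennreal ((norm (X n x - l x))\<^sup>2)"
        by (intro tendsto_intros)
      then show "ennreal ((norm (X n x - l x))\<^sup>2) = liminf (\<lambda>i. ennreal ((norm (X n x - X (r i) x))\<^sup>2))"
        by (rule lim_imp_Liminf[OF sequentially_bot, symmetric])
    qed
    also have "\<dots> \<le> liminf (\<lambda>i. \<integral>\<^sup>+x. ennreal ((norm (X n x - X (r i) x))\<^sup>2) \<partial>?M)"
      by (rule nn_integral_liminf) measurable
    also have "\<dots> \<le> liminf (\<lambda>i::nat. ennreal (e\<^sup>2))"
    proof (rule Liminf_mono, unfold eventually_sequentially, intro exI allI impI)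
      fix i assume "i \<ge> N"
      then have "r i \<ge> N" using seq_suble[OF r, of i] by linarith
      then have "(L2_norm \<Omega> (X n - X (r i)))\<^sup>2 \<le> e\<^sup>2"
        using N[of "r i"] by (intro power_mono) auto
      then show "(\<integral>\<^sup>+x. ennreal ((norm (X n x - X (r i) x))\<^sup>2) \<partial>?M) \<le> ennreal (e\<^sup>2)"
        using nn_integral_L2_norm[OF L2_diff[OF X X], of n "r i"] by (simp add: ennreal_leI)
    qed
    also have "\<dots> = ennreal (e\<^sup>2)" by (simp add: Liminf_const)
    finally show ?thesis .
  qed
  have diff_L2: "X n - l \<in> L2 \<Omega>" and diff_le: "L2_norm \<Omega> (X n - l) \<le> e"
    if e: "e > 0" and N: "\<And>m. m \<ge> N \<Longrightarrow> L2_norm \<Omega> (X n - X m) < e" for n e N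
  proof -
    have "(\<integral>\<^sup>+x. ennreal (norm ((norm (X n x - l x))\<^sup>2)) \<partial>?M) < \<infinity>"
      using le_less_trans[OF bound[OF e N] ennreal_less_top] by simp
    then have "integrable ?M (\<lambda>x. (norm (X n x - l x))\<^sup>2)"
      by (intro integrableI_bounded) measurable
    then show *: "X n - l \<in> L2 \<Omega>" by (simp add: L2_def fun_diff_def)
    have "ennreal ((L2_norm \<Omega> (X n - l))\<^sup>2) \<le> ennreal (e\<^sup>2)"
      using bound[OF e N] nn_integral_L2_norm[OF *] by simp
    then have "(L2_norm \<Omega> (X n - l))\<^sup>2 \<le> e\<^sup>2" by (simp add: ennreal_le_iff)
    then show "L2_norm \<Omega> (X n - l) \<le> e" using e by (rule power2_le_imp_le[OF _ less_imp_le])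
  qed
  \<comment> \<open>\<open>l\<close> is square integrable as \<open>X N\<close> minus the remainder
    \<open>X N - l\<close>, which Fatou's lemma controls.\<close>
  obtain N where "\<And>m. m \<ge> N \<Longrightarrow> L2_norm \<Omega> (X N - X m) < 1"
    using Cauchy[of 1] by auto
  then have "X N - l \<in> L2 \<Omega>" by (intro diff_L2[of 1 N]) auto
  then have "X N - (X N - l) \<in> L2 \<Omega>" by (rule L2_diff[OF X])
  moreover have "X N - (X N - l) = l" by (simp add: fun_eq_iff)
  ultimately have "l \<in> L2 \<Omega>" by simp
  moreover have "(\<lambda>n. L2_norm \<Omega> (X n - l)) \<longlonglongrightarrow> 0"
  proof (rule LIMSEQ_I)
    fix e :: real assume e: "e > 0"
    then obtain N where N: "\<And>m n. m \<ge> N \<Longrightarrow> n \<ge> N \<Longrightarrow> L2_norm \<Omega> (X m - X n) < e / 2"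
      using Cauchy[of "e / 2"] by auto
    have "L2_norm \<Omega> (X n - l) \<le> e / 2" if "n \<ge> N" for n
      using N[OF that] e by (intro diff_le[of "e / 2" N]) auto
    then have "L2_norm \<Omega> (X n - l) < e" if "n \<ge> N" for n
      using e that by (smt (verit) field_sum_of_halves)
    then show "\<exists>N. \<forall>n\<ge>N. norm (L2_norm \<Omega> (X n - l) - 0) < e"
      by auto
  qed
  ultimately show ?thesis by blast
qed

subsection \<open>Bump functions\<close>

text \<open>The derivatives of \<open>exp (- 1 / t)\<close> are linear combinations of the functions \<open>t\<^sup>-\<^sup>n exp (- 1 / t)\<close>,
  so this family is closed under differentiation.\<close>

definition exp_flat :: "nat \<Rightarrow> real \<Rightarrow> real" where
  "exp_flat n t = (if t \<le> 0 then 0 else (1 / t) ^ n * exp (- (1 / t)))"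

text \<open>This is the difference quotient at 0, the only point where differentiability is in
  doubt. The substitution s = 1 / t turns the right-hand limit into that of
  \<open>s ^ Suc n / exp s\<close> at infinity.\<close>

lemma exp_flat_over_t_tendsto_0: "((\<lambda>t. exp_flat n t / t) \<longlongrightarrow> 0) (at 0)"
proof -
  have "((\<lambda>t::real. (1 / t) ^ Suc n * exp (- (1 / t))) \<longlongrightarrow> 0) (at_right 0)"
  proof -
    have "((\<lambda>s::real. s ^ Suc n / exp s) \<longlongrightarrow> 0) at_top"
      by (rule tendsto_power_div_exp_0)
    then have "((\<lambda>t::real. inverse t ^ Suc n / exp (inverse t)) \<longlongrightarrow> 0) (at_right 0)"
      by (rule filterlim_compose[OF _ filterlim_inverse_at_top_right])
    then show ?thesis by (simp add: exp_minus divide_simps inverse_eq_divide)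
  qed
  moreover have "\<forall>\<^sub>F t in at_right 0. (1 / t) ^ Suc n * exp (- (1 / t)) = exp_flat n t / t"
    by (intro eventually_at_right_less[THEN eventually_mono]) (auto simp: exp_flat_def)
  ultimately have right: "((\<lambda>t. exp_flat n t / t) \<longlongrightarrow> 0) (at_right 0)"
    by (rule Lim_transform_eventually)
  have "\<forall>\<^sub>F t in at_left 0. 0 = exp_flat n t / t"
    by (auto simp: eventually_at_left_field exp_flat_def intro!: exI[of _ "-1"])
  then have "((\<lambda>t. exp_flat n t / t) \<longlongrightarrow> 0) (at_left 0)"
    by (rule Lim_transform_eventually[OF tendsto_const])
  with right show ?thesis by (simp add: filterlim_at_split)
qed

lemma exp_flat_has_real_derivative:
  "(exp_flat n has_real_derivative exp_flat (n + 2) t - real n * exp_flat (n + 1) t) (at t)"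
proof -
  consider "t < 0" | "t = 0" | "t > 0" by linarith
  then show ?thesis
  proof cases
    case 1
    have "((\<lambda>_. 0) has_real_derivative 0) (at t)" by simp
    then have "(exp_flat n has_real_derivative 0) (at t)"
      by (rule has_field_derivative_transform_within_open[of _ _ _ "{..<0}"]) (use 1 in \<open>auto simp: exp_flat_def\<close>)
    then show ?thesis using 1 by (simp add: exp_flat_def)
  next
    case 2
    show ?thesis
      unfolding 2 has_field_derivative_iff using exp_flat_over_t_tendsto_0[of n]
      by (simp add: exp_flat_def[of _ 0])
  next
    case 3
    have "((\<lambda>t. (1 / t) ^ n * exp (- (1 / t))) has_real_derivative
        exp_flat (n + 2) t - real n * exp_flat (n + 1) t) (at t)"
      using 3
      using power_minus_mult[of n t]
      by (cases "n = 0") (auto intro!: derivative_eq_intros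
        simp: exp_flat_def divide_simps power2_eq_square algebra_simps)
    then show ?thesis
      by (rule has_field_derivative_transform_within_open[of _ _ _ "{0<..}"]) (use 3 in \<open>auto simp: exp_flat_def\<close>)
  qed
qed

lemma exp_flat_nonneg: "0 \<le> exp_flat n t"
  by (simp add: exp_flat_def)

lemma exp_flat_0_le_1: "exp_flat 0 t \<le> 1"
  by (simp add: exp_flat_def)

lemma exp_flat_eq_0_iff: "exp_flat n t = 0 \<longleftrightarrow> t \<le> 0"
  by (simp add: exp_flat_def)

lemma exp_flat_0_tendsto_1:
  assumes "t > 0" shows "(\<lambda>n. exp_flat 0 (real (Suc n) * t)) \<longlonglongrightarrow> 1"
proof -
  have "(\<lambda>n. exp (- (inverse (real (Suc n)) * (1 / t)))) \<longlonglongrightarrow> exp (- (0 * (1 / t)))"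
    by (intro tendsto_intros LIMSEQ_inverse_real_of_nat)
  moreover have "exp (- (inverse (real (Suc n)) * (1 / t))) = exp_flat 0 (real (Suc n) * t)" for n
    using assms by (simp add: exp_flat_def divide_simps mult_le_0_iff)
  ultimately show ?thesis by simp
qed

section \<open>Rules for iterated differentiability\<close>

lemma times_cont_diff_imp_continuous: "times_cont_diff n f \<Longrightarrow> continuous_on UNIV f"
  by (cases n) (auto intro: differentiable_imp_continuous_on)

lemma times_cont_diff_const: "times_cont_diff n (\<lambda>x. c)"
  by (induction n arbitrary: c) (auto simp: frechet_derivative_const)

lemma times_cont_diff_SucI:
  assumes "\<And>x. (f has_derivative f' x) (at x)" "\<And>v. times_cont_diff n (\<lambda>x. f' x v)"
  shows "times_cont_diff (Suc n) f"
proof -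
  have "frechet_derivative f (at x) = f' x" for x
    using frechet_derivative_at[OF assms(1)] by simp
  then show ?thesis
    using assms by (auto simp: differentiable_on_def differentiable_def)
qed

lemma times_cont_diff_Suc_has_derivative:
  assumes "times_cont_diff (Suc n) f"
  shows "(f has_derivative frechet_derivative f (at x)) (at x)"
  using assms by (simp add: differentiable_on_def frechet_derivative_works[symmetric])

lemma times_cont_diff_SucD: "times_cont_diff (Suc n) f \<Longrightarrow> times_cont_diff n f"
  by (induction n arbitrary: f) (auto intro: differentiable_imp_continuous_on)

lemma times_cont_diff_add:
  "times_cont_diff n f \<Longrightarrow> times_cont_diff n g \<Longrightarrow> times_cont_diff n (\<lambda>x. f x + g x)"
proof (induction n arbitrary: f g)
  case (Suc n)
  show ?case
    by (rule times_cont_diff_SucI,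
      rule has_derivative_add[OF Suc.prems[THEN times_cont_diff_Suc_has_derivative]])
      (use Suc in auto)
qed (auto intro: continuous_on_add)

lemma times_cont_diff_bounded_linear:
  assumes "bounded_linear h"
  shows "times_cont_diff n f \<Longrightarrow> times_cont_diff n (\<lambda>x. h (f x))"
proof (induction n arbitrary: f)
  case 0
  then show ?case using assms by (auto intro: bounded_linear.continuous_on)
next
  case (Suc n)
  show ?case
    by (rule times_cont_diff_SucI,
      rule bounded_linear.has_derivative[OF assms Suc.prems[THEN times_cont_diff_Suc_has_derivative]])
      (use Suc in auto)
qed

lemma times_cont_diff_mult:
  fixes f g :: "'a::euclidean_space \<Rightarrow> real"
  shows "times_cont_diff n f \<Longrightarrow> times_cont_diff n g \<Longrightarrow> times_cont_diff n (\<lambda>x. f x * g x)"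
proof (induction n arbitrary: f g)
  case (Suc n)
  show ?case
    by (rule times_cont_diff_SucI,
      rule has_derivative_mult[OF Suc.prems[THEN times_cont_diff_Suc_has_derivative]])
      (use Suc Suc.prems[THEN times_cont_diff_SucD] in \<open>auto intro!: times_cont_diff_add\<close>)
qed (auto intro: continuous_on_mult)

lemma times_cont_diff_prod:
  fixes f :: "'i \<Rightarrow> 'a::euclidean_space \<Rightarrow> real"
  assumes "finite I" "\<And>i. i \<in> I \<Longrightarrow> times_cont_diff n (f i)"
  shows "times_cont_diff n (\<lambda>x. \<Prod>i\<in>I. f i x)"
  using assms by (induction rule: finite_induct) (auto intro: times_cont_diff_const times_cont_diff_mult)

text \<open>The induction treats all \<open>k\<close> at once, because differentiating
  \<open>exp_flat k\<close> produces the indices \<open>k + 1\<close> and \<open>k + 2\<close>.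
  Affine arguments are enough, since bumps on boxes are products of functions of one
  coordinate.\<close>

lemma times_cont_diff_exp_flat_affine:
  fixes d :: "'a::euclidean_space"
  shows "times_cont_diff n (\<lambda>x. exp_flat k (d \<bullet> x + e))"
proof (induction n arbitrary: k)
  case 0
  have "continuous_on UNIV (exp_flat k)"
    using exp_flat_has_real_derivative by (intro DERIV_continuous_on) auto
  then show ?case
    by (auto intro!: continuous_on_compose2[of UNIV "exp_flat k"] continuous_intros)
next
  case (Suc n)
  define h where "h t = exp_flat (k + 2) t - real k * exp_flat (k + 1) t" for t
  show ?case
  proof (rule times_cont_diff_SucI)
    fix x :: 'a
    have "((\<lambda>x. d \<bullet> x + e) has_derivative (\<lambda>v. d \<bullet> v)) (at x)"
      by (auto intro!: derivative_eq_intros)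
    from has_derivative_compose[OF this exp_flat_has_real_derivative[of k, unfolded has_field_derivative_def]]
    show "((\<lambda>x. exp_flat k (d \<bullet> x + e)) has_derivative (\<lambda>v. h (d \<bullet> x + e) * (d \<bullet> v))) (at x)"
      by (simp add: h_def)
  next
    fix v
    have "times_cont_diff n (\<lambda>x. exp_flat (k + 2) (d \<bullet> x + e) + - real k * exp_flat (k + 1) (d \<bullet> x + e))"
      by (intro times_cont_diff_add times_cont_diff_mult times_cont_diff_const Suc)
    then have "times_cont_diff n (\<lambda>x. h (d \<bullet> x + e))" by (simp add: h_def)
    then show "times_cont_diff n (\<lambda>x. h (d \<bullet> x + e) * (d \<bullet> v))"
      by (intro times_cont_diff_mult times_cont_diff_const)
  qed
qed

text \<open>Smooth approximations of the indicator of the open box: each factor is positive exactly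
  on the inner side of its face and tends to 1 there as the slope grows. \<open>Suc n\<close> keeps
  the set of nonzero values equal to the box for every \<open>n\<close>, including 0.\<close>

definition box_bump :: "real^3 \<Rightarrow> real^3 \<Rightarrow> nat \<Rightarrow> real^3 \<Rightarrow> real" where
  "box_bump p q n x =
     (\<Prod>i\<in>UNIV. exp_flat 0 (real (Suc n) * (x $ i - p $ i)) * exp_flat 0 (real (Suc n) * (q $ i - x $ i)))"

lemma times_cont_diff_box_bump: "times_cont_diff m (box_bump p q n)"
proof -
  have "times_cont_diff m (\<lambda>x. exp_flat 0 (real (Suc n) * (x $ i - p $ i)))" for i :: 3
    using times_cont_diff_exp_flat_affine[of m 0 "real (Suc n) *\<^sub>R axis i (1::real)" "- real (Suc n) * p $ i"]
    by (simp add: inner_axis' inner_real_def algebra_simps)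
  moreover have "times_cont_diff m (\<lambda>x. exp_flat 0 (real (Suc n) * (q $ i - x $ i)))" for i :: 3
    using times_cont_diff_exp_flat_affine[of m 0 "- real (Suc n) *\<^sub>R axis i (1::real)" "real (Suc n) * q $ i"]
    by (simp add: inner_axis' inner_real_def algebra_simps)
  ultimately have "times_cont_diff m (\<lambda>x. \<Prod>i\<in>(UNIV::3 set). exp_flat 0 (real (Suc n) * (x $ i - p $ i))
      * exp_flat 0 (real (Suc n) * (q $ i - x $ i)))"
    by (intro times_cont_diff_prod times_cont_diff_mult) auto
  then show ?thesis by (simp add: box_bump_def[abs_def])
qed

lemma box_bump_nonneg: "0 \<le> box_bump p q n x"
  by (simp add: box_bump_def prod_nonneg exp_flat_nonneg)

lemma box_bump_le_1: "box_bump p q n x \<le> 1"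
  unfolding box_bump_def
  by (intro prod_le_1 conjI mult_nonneg_nonneg exp_flat_nonneg mult_le_one exp_flat_0_le_1)

lemma box_bump_eq_0_iff: "box_bump p q n x = 0 \<longleftrightarrow> x \<notin> box p q"
  by (auto simp: box_bump_def mem_box_cart exp_flat_eq_0_iff mult_le_0_iff not_less)

lemma box_bump_tendsto: "(\<lambda>n. box_bump p q n x) \<longlonglongrightarrow> indicator (box p q) x"
proof (cases "x \<in> box p q")
  case True
  have "(\<lambda>n. box_bump p q n x) \<longlonglongrightarrow> (\<Prod>i\<in>(UNIV::3 set). 1 * 1)"
    unfolding box_bump_def using True
    by (intro tendsto_prod tendsto_mult exp_flat_0_tendsto_1) (auto simp: mem_box_cart)
  then show ?thesis using True by simp
next
  case False
  then have "box_bump p q n x = 0" for n by (simp add: box_bump_eq_0_iff)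
  then show ?thesis using False by simp
qed

lemma box_bump_test_field:
  assumes "cbox p q \<subseteq> \<Omega>"
  shows "(\<lambda>x. box_bump p q n x *\<^sub>R z) \<in> test_fields \<Omega>"
proof -
  have sub: "closure {x. box_bump p q n x *\<^sub>R z \<noteq> 0} \<subseteq> cbox p q"
    using box_subset_cbox[of p q] by (intro closure_minimal) (auto simp: box_bump_eq_0_iff)
  then have "compact (closure {x. box_bump p q n x *\<^sub>R z \<noteq> 0})"
    by (meson bounded_cbox bounded_subset compact_eq_bounded_closed closed_closure)
  moreover have "times_cont_diff m (\<lambda>x. box_bump p q n x *\<^sub>R z)" for m
    by (intro times_cont_diff_bounded_linear[where h = "\<lambda>r. r *\<^sub>R z"] bounded_linear_scaleR_left times_cont_diff_box_bump)
  ultimately show ?thesis using sub assms by (auto simp: test_fields_def)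
qed

subsection \<open>The fundamental lemma of the calculus of variations\<close>

lemma sigma_finite_lebesgue: "sigma_finite_measure (lebesgue :: 'a::euclidean_space measure)"
proof
  obtain A :: "'a set set" where A: "countable A" "A \<subseteq> sets lborel" "\<Union>A = space lborel"
    "\<forall>a\<in>A. emeasure lborel a \<noteq> \<infinity>"
    using lborel.sigma_finite_countable by blast
  then show "\<exists>A. countable A \<and> A \<subseteq> sets lebesgue \<and> \<Union>A = space (lebesgue :: 'a measure) \<and> (\<forall>a\<in>A. emeasure lebesgue a \<noteq> \<infinity>)"
    by (intro exI[of _ A]) (auto simp: emeasure_completion subset_iff)
qed

text \<open>A Dynkin argument: open boxes are stable under intersection and generate the Borel sets,
  and the sets with zero integral are closed under disjoint unions and, by \<open>total\<close>,
  under complements. Lebesgue sets are reached because they differ from F-sigma sets by null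
  sets.\<close>

lemma integral_box_zero_imp_AE_zero:
  fixes f :: "'a::euclidean_space \<Rightarrow> 'b::{banach, second_countable_topology}"
  assumes int: "integrable lebesgue f"
    and total: "integral\<^sup>L lebesgue f = 0"
    and box: "\<And>p q. (LINT x:box p q|lebesgue. f x) = 0"
  shows "AE x in lebesgue. f x = 0"
proof -
  interpret sigma_finite_measure "lebesgue :: 'a measure" by (rule sigma_finite_lebesgue)
  have si: "set_integrable lebesgue A f" if "A \<in> sets lebesgue" for A
    unfolding set_integrable_def using that int by (rule integrable_mult_indicator)
  have borel: "(LINT x:A|lebesgue. f x) = 0" if A: "A \<in> sets borel" for A
  proof -
    have sets: "B \<in> sets borel" if "B \<in> sigma_sets UNIV (range (\<lambda>(a, b). box a b :: 'a set))" for B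
      using that unfolding borel_eq_box by simp
    have "Int_stable (range (\<lambda>(a, b). box a b :: 'a set))"
      by (auto simp: Int_stable_def box_Int_box)
    moreover have "(range (\<lambda>(a, b). box a b :: 'a set)) \<subseteq> Pow UNIV" by auto
    moreover have "A \<in> sigma_sets UNIV (range (\<lambda>(a, b). box a b))"
      using A unfolding borel_eq_box by simp
    ultimately show ?thesis
    proof (induction rule: sigma_sets_induct_disjoint)
      case (basic A)
      then show ?case using box by auto
    next
      case empty
      show ?case by (simp add: set_lebesgue_integral_def)
    next
      case (compl A)
      have A: "A \<in> sets lebesgue" using sets[OF compl(1)] by simp
      have "(LINT x:A \<union> (UNIV - A)|lebesgue. f x)
          = (LINT x:A|lebesgue. f x) + (LINT x:UNIV - A|lebesgue. f x)"
        using A si sets.compl_sets[OF A] by (intro set_integral_Un) auto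
      moreover have "(LINT x:A \<union> (UNIV - A)|lebesgue. f x) = 0"
        using total by (simp add: set_lebesgue_integral_def)
      ultimately show ?case using compl by simp
    next
      case (union A)
      have "A i \<in> sets lebesgue" for i using sets[of "A i"] union(2) by (auto simp: subset_iff)
      then have "(LINT x:(\<Union>i. A i)|lebesgue. f x) = (\<Sum>i. (LINT x:(A i)|lebesgue. f x))"
        using union(1) by (intro lebesgue_integral_countable_add si) (auto simp: disjoint_family_on_def)
      then show ?case using union(3) by simp
    qed
  qed
  show ?thesis
  proof (rule density_zero[OF int])
    fix A :: "'a set" assume "A \<in> sets lebesgue"
    then obtain C T where C: "fsigma C" and T: "T \<in> null_sets lebesgue" and CT: "C \<union> T = A"
      using lebesgue_set_almost_fsigma by metis
    have "C \<in> sets borel" using C by (auto elim!: fsigma.cases intro: borel_closed)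
    then have "(LINT x:C|lebesgue. f x) = 0" by (rule borel)
    moreover have "(LINT x:A|lebesgue. f x) = (LINT x:C|lebesgue. f x)"
      unfolding set_lebesgue_integral_def
    proof (rule integral_cong_AE)
      show "AE x in lebesgue. indicat_real A x *\<^sub>R f x = indicat_real C x *\<^sub>R f x"
        using AE_not_in[OF T] by eventually_elim (use CT in \<open>auto simp: indicator_def\<close>)
    qed (use si[OF \<open>A \<in> sets lebesgue\<close>] si[of C] \<open>C \<in> sets borel\<close> in
        \<open>auto simp: set_integrable_def dest: borel_measurable_integrable\<close>)
    ultimately show "(LINT x:A|lebesgue. f x) = 0" by simp
  qed
qed

text \<open>On a box, test fields converging to the indicator show that all integrals over smaller boxes
  vanish.\<close>

lemma orthogonal_test_fields_imp_AE_zero: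
  assumes \<Omega>: "open \<Omega>" and c: "c \<in> L2 \<Omega>"
    and orth: "\<And>\<phi>. \<phi> \<in> test_fields \<Omega> \<Longrightarrow> L2_inner \<Omega> c \<phi> = 0"
  shows "AE x in lebesgue_on \<Omega>. c x = 0"
proof -
  have \<Omega>m: "\<Omega> \<in> sets lebesgue" using \<Omega> by auto
  have ind_eq: "indicator \<Omega> x *\<^sub>R (indicator B x *\<^sub>R c x) = indicator B x *\<^sub>R c x" if "B \<subseteq> \<Omega>" for B x
    using that by (auto simp: indicator_def)
  \<comment> \<open>The measure of \<open>\<Omega>\<close> may be infinite here, so \<open>c\<close>
    is integrable only on bounded boxes, by
    \<open>norm (c x) \<le> (norm (c x))\<^sup>2 + 1\<close>. This is also the dominating function
    for the bumps.\<close>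
  have int_cbox: "integrable (lebesgue_on \<Omega>) (\<lambda>x. indicator (cbox p q) x *\<^sub>R c x)" for p q
  proof (rule Bochner_Integration.integrable_bound)
    have "integrable (lebesgue_on \<Omega>) (indicat_real (cbox p q))"
    proof -
      have "integrable lebesgue (\<lambda>x. indicat_real \<Omega> x *\<^sub>R indicat_real (cbox p q) x)"
        using \<Omega>m by (intro integrable_mult_indicator) (auto simp: integrable_indicator_iff emeasure_lborel_cbox_eq)
      then show ?thesis using \<Omega>m by (simp add: integrable_restrict_space)
    qed
    then show "integrable (lebesgue_on \<Omega>) (\<lambda>x. (norm (c x))\<^sup>2 + indicator (cbox p q) x)"
      using L2_integrable[OF c] by simp
    show "(\<lambda>x. indicat_real (cbox p q) x *\<^sub>R c x) \<in> borel_measurable (lebesgue_on \<Omega>)"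
      by (intro borel_measurable_scaleR L2_measurable[OF c] measurable_restrict_space1
        borel_measurable_indicator) simp
    have "norm (c x) \<le> (norm (c x))\<^sup>2 + 1" for x
      using sum_squares_bound[of "norm (c x)" 1] norm_ge_zero[of "c x"]
      unfolding mult_1_right power_one by linarith
    then show "AE x in lebesgue_on \<Omega>. norm (indicat_real (cbox p q) x *\<^sub>R c x)
        \<le> norm ((norm (c x))\<^sup>2 + indicat_real (cbox p q) x)"
      by (auto simp: indicator_def)
  qed
  have bump_le: "norm (box_bump p q n x *\<^sub>R c x) \<le> norm (indicat_real (cbox p q) x *\<^sub>R c x)" for p q n x
  proof (cases "x \<in> cbox p q")
    case True
    then show ?thesis
      using box_bump_nonneg[of p q n x] box_bump_le_1[of p q n x] by (simp add: mult_left_le_one_le)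
  next
    case False
    then have "box_bump p q n x = 0" using box_subset_cbox[of p q] by (auto simp: box_bump_eq_0_iff)
    then show ?thesis by simp
  qed
  have box_sets: "box p q \<in> sets (lebesgue_on \<Omega>)" if "box p q \<subseteq> \<Omega>" for p q
    using that \<Omega>m by (auto simp: sets_restrict_space image_iff intro!: bexI[of _ "box p q"])
  have box0: "(LINT x|lebesgue_on \<Omega>. indicator (box p q) x *\<^sub>R c x) = 0"
    if sub: "cbox p q \<subseteq> \<Omega>" for p q
  proof -
    have bump0: "(LINT x|lebesgue_on \<Omega>. box_bump p q n x *\<^sub>R c x) = 0" for n
    proof -
      have meas: "box_bump p q n \<in> borel_measurable (lebesgue_on \<Omega>)"
        using times_cont_diff_imp_continuous[OF times_cont_diff_box_bump[of 0 p q n]] \<Omega>m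
        by (intro continuous_imp_measurable_on_sets_lebesgue) (auto intro: continuous_on_subset)
      have int: "integrable (lebesgue_on \<Omega>) (\<lambda>x. box_bump p q n x *\<^sub>R c x)"
      proof (rule Bochner_Integration.integrable_bound[OF int_cbox[of p q]])
        show "AE x in lebesgue_on \<Omega>. norm (box_bump p q n x *\<^sub>R c x) \<le> norm (indicat_real (cbox p q) x *\<^sub>R c x)"
          by (intro AE_I2 bump_le)
      qed (intro borel_measurable_scaleR meas L2_measurable[OF c])
      show ?thesis
      proof (subst vec_eq_iff, intro allI)
        fix i :: 3
        \<comment> \<open>A bump times the \<open>i\<close>-th unit vector isolates the
          \<open>i\<close>-th component of \<open>c\<close>.\<close>
        have "0 = L2_inner \<Omega> c (\<lambda>x. box_bump p q n x *\<^sub>R axis i 1)"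
          using orth[OF box_bump_test_field[OF sub]] by simp
        also have "\<dots> = (LINT x|lebesgue_on \<Omega>. (box_bump p q n x *\<^sub>R c x) $ i)"
          unfolding L2_inner_def
          by (intro Bochner_Integration.integral_cong refl)
            (simp add: axis_def if_distrib[of cnj] if_distrib[of "(*) _"] if_distrib[of "(*\<^sub>R) _"] scaleR_conv_of_real[where 'a = complex] cong: if_cong)
        also have "\<dots> = (LINT x|lebesgue_on \<Omega>. box_bump p q n x *\<^sub>R c x) $ i"
          by (rule integral_bounded_linear[OF bounded_linear_vec_nth int])
        finally show "(LINT x|lebesgue_on \<Omega>. box_bump p q n x *\<^sub>R c x) $ i = 0 $ i" by simp
      qed
    qed
    have "(\<lambda>n. LINT x|lebesgue_on \<Omega>. box_bump p q n x *\<^sub>R c x)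
        \<longlonglongrightarrow> (LINT x|lebesgue_on \<Omega>. indicator (box p q) x *\<^sub>R c x)"
    proof (rule integral_dominated_convergence)
      show "integrable (lebesgue_on \<Omega>) (\<lambda>x. norm (indicat_real (cbox p q) x *\<^sub>R c x))"
        using int_cbox by (rule integrable_norm)
      show "AE x in lebesgue_on \<Omega>. (\<lambda>n. box_bump p q n x *\<^sub>R c x) \<longlonglongrightarrow> indicator (box p q) x *\<^sub>R c x"
        by (intro AE_I2 tendsto_intros box_bump_tendsto)
      show "AE x in lebesgue_on \<Omega>. norm (box_bump p q n x *\<^sub>R c x) \<le> norm (indicat_real (cbox p q) x *\<^sub>R c x)" for n
        by (intro AE_I2 bump_le)
      show "(\<lambda>x. box_bump p q n x *\<^sub>R c x) \<in> borel_measurable (lebesgue_on \<Omega>)" for n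
        using times_cont_diff_imp_continuous[OF times_cont_diff_box_bump[of 0 p q n]] \<Omega>m
        by (intro borel_measurable_scaleR L2_measurable[OF c] continuous_imp_measurable_on_sets_lebesgue)
          (auto intro: continuous_on_subset)
      show "(\<lambda>x. indicat_real (box p q) x *\<^sub>R c x) \<in> borel_measurable (lebesgue_on \<Omega>)"
        using sub box_subset_cbox[of p q]
        by (intro borel_measurable_scaleR borel_measurable_indicator L2_measurable[OF c] box_sets) auto
    qed
    then show ?thesis unfolding bump0 by (simp add: LIMSEQ_const_iff)
  qed
  have AE_cbox: "AE x in lebesgue. x \<in> cbox p q \<longrightarrow> c x = 0" if sub: "cbox p q \<subseteq> \<Omega>" for p q
  proof -
    have bsub: "box p q \<subseteq> \<Omega>" using sub box_subset_cbox by blast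
    let ?f = "\<lambda>x. indicat_real (box p q) x *\<^sub>R c x"
    have eq: "(LINT x:box r s|lebesgue. ?f x) = (LINT x|lebesgue_on \<Omega>. indicator (box r s \<inter> box p q) x *\<^sub>R c x)" for r s
    proof -
      have "(LINT x|lebesgue_on \<Omega>. indicator (box r s \<inter> box p q) x *\<^sub>R c x)
          = (LINT x|lebesgue. indicator \<Omega> x *\<^sub>R (indicator (box r s \<inter> box p q) x *\<^sub>R c x))"
        using \<Omega>m by (intro integral_restrict_space) auto
      also have "\<dots> = (LINT x:box r s|lebesgue. ?f x)"
        unfolding set_lebesgue_integral_def using bsub
        by (intro Bochner_Integration.integral_cong) (auto simp: indicator_def)
      finally show ?thesis by simp
    qed
    \<comment> \<open>The intersection is again an open box. When it is nonempty, taking closures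
      shows that its closed version lies in \<open>cbox p q\<close>, so \<open>box0\<close> applies
      to it.\<close>
    have zero: "(LINT x|lebesgue_on \<Omega>. indicator (box r s \<inter> box p q) x *\<^sub>R c x) = 0" for r s
    proof (cases "box r s \<inter> box p q = {}")
      case False
      obtain r' s' where rs: "box r s \<inter> box p q = box r' s'" by (auto simp: box_Int_box)
      then have "closure (box r' s') \<subseteq> closure (box p q)" by (intro closure_mono) auto
      moreover have "box p q \<noteq> {}" "box r' s' \<noteq> {}" using False rs by auto
      ultimately have "cbox r' s' \<subseteq> cbox p q" by (simp add: closure_box)
      then show ?thesis using box0[of r' s'] sub rs by auto
    qed simp
    have "AE x in lebesgue. ?f x = 0"
    proof (rule integral_box_zero_imp_AE_zero)
      have "integrable (lebesgue_on \<Omega>) ?f"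
      proof (rule Bochner_Integration.integrable_bound[OF int_cbox[of p q]])
        show "?f \<in> borel_measurable (lebesgue_on \<Omega>)"
          by (intro borel_measurable_scaleR borel_measurable_indicator L2_measurable[OF c] box_sets bsub)
      qed (use box_subset_cbox[of p q] in \<open>auto simp: indicator_def\<close>)
      then show "integrable lebesgue ?f"
        by (subst (asm) integrable_restrict_space) (simp_all only: ind_eq[OF bsub], use \<Omega>m in simp)
      show "integral\<^sup>L lebesgue ?f = 0"
        using zero[of p q] eq[of p q]
        by (simp add: set_lebesgue_integral_def indicator_inter_arith[symmetric])
      show "(LINT x:box r s|lebesgue. ?f x) = 0" for r s
        using zero eq by simp
    qed
    moreover have "AE x in lebesgue. x \<notin> cbox p q - box p q"
      using negligible_frontier_interval[of p q] by (intro AE_not_in) (simp add: negligible_iff_null_sets)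
    ultimately show ?thesis by eventually_elim (auto simp: indicator_def split: if_splits)
  qed
  \<comment> \<open>Countably many closed boxes cover \<open>\<Omega>\<close>, so the exceptional
    null sets can be united.\<close>
  obtain D where D: "countable D" "D \<subseteq> Pow \<Omega>" "\<And>X. X \<in> D \<Longrightarrow> \<exists>a b. X = cbox a b" "\<Union>D = \<Omega>"
    using open_countable_Union_open_cbox[OF \<Omega>] by metis
  have "AE x in lebesgue. \<forall>X\<in>D. x \<in> X \<longrightarrow> c x = 0"
  proof (subst AE_ball_countable[OF D(1)], intro ballI)
    fix X assume "X \<in> D"
    with D obtain a b where "X = cbox a b" "cbox a b \<subseteq> \<Omega>" by blast
    then show "AE x in lebesgue. x \<in> X \<longrightarrow> c x = 0" using AE_cbox by simp
  qed
  then have "AE x in lebesgue. x \<in> \<Omega> \<longrightarrow> c x = 0"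
    by eventually_elim (use D(4) in auto)
  then show ?thesis using \<Omega>m by (simp add: AE_restrict_space_iff)
qed

subsection \<open>Weak curls and vanishing tangential traces\<close>

lemma continuous_compact_support_in_L2:
  assumes \<Omega>: "\<Omega> \<in> sets lebesgue" and cont: "continuous_on UNIV \<phi>"
    and K: "compact K" and zero: "\<And>x. x \<notin> K \<Longrightarrow> \<phi> x = 0"
  shows "\<phi> \<in> L2 \<Omega>"
proof -
  have "integrable lborel (\<lambda>x. indicator K x *\<^sub>R (norm (\<phi> x))\<^sup>2)"
    using K cont by (intro borel_integrable_compact continuous_intros) (auto intro: continuous_on_subset)
  moreover have "(\<lambda>x. indicator K x *\<^sub>R (norm (\<phi> x))\<^sup>2) = (\<lambda>x. (norm (\<phi> x))\<^sup>2)"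
    using zero by (auto simp: indicator_def fun_eq_iff)
  ultimately have "integrable lborel (\<lambda>x. (norm (\<phi> x))\<^sup>2)" by simp
  then have "integrable lebesgue (\<lambda>x. (norm (\<phi> x))\<^sup>2)"
    by (subst integrable_completion) (simp_all add: borel_measurable_integrable)
  then have "integrable lebesgue (\<lambda>x. indicator \<Omega> x *\<^sub>R (norm (\<phi> x))\<^sup>2)"
    using \<Omega> by (intro integrable_mult_indicator)
  then have "integrable (lebesgue_on \<Omega>) (\<lambda>x. (norm (\<phi> x))\<^sup>2)"
    using \<Omega> by (subst integrable_restrict_space) simp_all
  moreover have "\<phi> \<in> borel_measurable (lebesgue_on \<Omega>)"
    using cont \<Omega> by (intro continuous_imp_measurable_on_sets_lebesgue) (auto intro: continuous_on_subset)
  ultimately show ?thesis by (simp add: L2_def)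
qed

lemma
  assumes \<phi>: "\<phi> \<in> test_fields \<Omega>" and \<Omega>: "open \<Omega>"
  shows test_field_L2: "\<phi> \<in> L2 \<Omega>" and partial_deriv_L2: "partial_deriv j \<phi> \<in> L2 \<Omega>"
proof -
  define K where "K = closure {x. \<phi> x \<noteq> 0}"
  have K: "compact K" and tcd: "\<And>n. times_cont_diff n \<phi>"
    using \<phi> by (auto simp: test_fields_def K_def)
  have zero: "\<phi> x = 0" if "x \<notin> K" for x
    using that closure_subset[of "{x. \<phi> x \<noteq> 0}"] by (auto simp: K_def)
  have \<Omega>m: "\<Omega> \<in> sets lebesgue" using \<Omega> by auto
  show "\<phi> \<in> L2 \<Omega>"
    using continuous_compact_support_in_L2[OF \<Omega>m times_cont_diff_imp_continuous[OF tcd] K zero] .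
  have "times_cont_diff 0 (\<lambda>x. frechet_derivative \<phi> (at x) (axis j 1))"
    using tcd[of "Suc 0"] by auto
  then have cont: "continuous_on UNIV (partial_deriv j \<phi>)"
    by (simp add: partial_deriv_def[abs_def])
  have pzero: "partial_deriv j \<phi> x = 0" if "x \<notin> K" for x
  proof -
    have "((\<lambda>_. 0) has_derivative (\<lambda>_. 0)) (at x)" by simp
    then have "(\<phi> has_derivative (\<lambda>_. 0)) (at x)"
      by (rule has_derivative_transform_within_open[of _ _ _ _ "- K"])
        (use K that zero in \<open>auto intro: compact_imp_closed\<close>)
    then show ?thesis by (simp add: partial_deriv_def frechet_derivative_at[symmetric])
  qed
  show "partial_deriv j \<phi> \<in> L2 \<Omega>"
    using continuous_compact_support_in_L2[OF \<Omega>m cont K pzero] .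
qed

text \<open>The cross product with the \<open>j\<close>-th unit vector, so that \<open>curl \<phi> = \<Sum>\<^sub>j e\<^sub>j \<times> \<partial>\<^sub>j \<phi>\<close>.\<close>

definition cross_axis :: "3 \<Rightarrow> complex^3 \<Rightarrow> complex^3" where
  "cross_axis j v = (if j = 1 then vector [0, - v $ 3, v $ 2]
     else if j = 2 then vector [v $ 3, 0, - v $ 1] else vector [- v $ 2, v $ 1, 0])"

lemma bounded_linear_cross_axis: "bounded_linear (cross_axis j)"
  unfolding linear_conv_bounded_linear[symmetric]
  by (rule linearI) (auto simp: cross_axis_def vec_eq_iff forall_3 vector_3)

text \<open>The matrix of \<open>cross_axis j\<close> is real and antisymmetric. Its sign cancels
  the one in \<open>has_weak_partial\<close>, so that no sign remains in
  \<open>has_weak_curl\<close>.\<close>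

lemma herm_cross_axis: "herm (cross_axis j v) w = - herm v (cross_axis j w)"
  by (auto simp: herm_def cross_axis_def sum_3 vector_3)

lemma classical_curl_eq: "classical_curl \<phi> = (\<Sum>j\<in>UNIV. (\<lambda>x. cross_axis j (partial_deriv j \<phi> x)))"
  by (auto simp: fun_eq_iff vec_eq_iff forall_3 sum_3 classical_curl_def cross_axis_def vector_3)

lemma L2_bounded_linear:
  fixes h :: "complex^3 \<Rightarrow> complex^3"
  assumes h: "bounded_linear h" and v: "v \<in> L2 \<Omega>"
  shows "(\<lambda>x. h (v x)) \<in> L2 \<Omega>"
proof -
  obtain C where C: "\<And>x. norm (h x) \<le> norm x * C" using bounded_linear.bounded[OF h] by blast
  have meas: "(\<lambda>x. h (v x)) \<in> borel_measurable (lebesgue_on \<Omega>)"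
    using borel_measurable_continuous_on[OF linear_continuous_on[OF h] L2_measurable[OF v]] .
  have "integrable (lebesgue_on \<Omega>) (\<lambda>x. (norm (h (v x)))\<^sup>2)"
  proof (rule Bochner_Integration.integrable_bound)
    show "integrable (lebesgue_on \<Omega>) (\<lambda>x. (norm (v x))\<^sup>2 * C\<^sup>2)"
      using L2_integrable[OF v] by simp
    show "AE x in lebesgue_on \<Omega>. norm ((norm (h (v x)))\<^sup>2) \<le> norm ((norm (v x))\<^sup>2 * C\<^sup>2)"
      using C by (auto simp: power_mult_distrib[symmetric] intro!: power_mono AE_I2)
  qed (use meas in measurable)
  with meas show ?thesis by (simp add: L2_def)
qed

lemmas L2_cross_axis = L2_bounded_linear[OF bounded_linear_cross_axis]

lemma L2_sum: "(\<And>i. i \<in> I \<Longrightarrow> v i \<in> L2 \<Omega>) \<Longrightarrow> (\<Sum>i\<in>I. v i) \<in> L2 \<Omega>"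
  by (rule subspace_sum[OF subspace_L2])

lemma L2_inner_sum_left:
  assumes "finite I" "\<And>i. i \<in> I \<Longrightarrow> v i \<in> L2 \<Omega>" "w \<in> L2 \<Omega>"
  shows "L2_inner \<Omega> (\<Sum>i\<in>I. v i) w = (\<Sum>i\<in>I. L2_inner \<Omega> (v i) w)"
  using assms
proof (induction rule: finite_induct)
  case empty
  then show ?case by (simp add: L2_inner_def)
next
  case (insert i I)
  have "(\<Sum>j\<in>insert i I. v j) = v i + (\<Sum>j\<in>I. v j)" using insert by (intro sum.insert)
  with insert show ?case
    by (simp only: L2_inner_add_left L2_sum insert_iff simp_thms sum.insert)
qed

lemma L2_inner_sum_right:
  assumes "finite I" "\<And>i. i \<in> I \<Longrightarrow> v i \<in> L2 \<Omega>" "w \<in> L2 \<Omega>"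
  shows "L2_inner \<Omega> w (\<Sum>i\<in>I. v i) = (\<Sum>i\<in>I. L2_inner \<Omega> w (v i))"
  using assms
proof (induction rule: finite_induct)
  case empty
  then show ?case by (simp add: L2_inner_def)
next
  case (insert i I)
  have "(\<Sum>j\<in>insert i I. v j) = v i + (\<Sum>j\<in>I. v j)" using insert by (intro sum.insert)
  with insert show ?case
    by (simp only: L2_inner_add_right L2_sum insert_iff simp_thms sum.insert)
qed

lemma classical_curl_L2:
  assumes "\<phi> \<in> test_fields \<Omega>" "open \<Omega>"
  shows "classical_curl \<phi> \<in> L2 \<Omega>"
  unfolding classical_curl_eq using assms
  by (intro L2_sum L2_cross_axis partial_deriv_L2)

lemma test_fields_bounded_linear:
  assumes h: "bounded_linear h" and \<phi>: "\<phi> \<in> test_fields \<Omega>"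
  shows "(\<lambda>x. h (\<phi> x)) \<in> test_fields \<Omega>"
proof -
  have "{x. h (\<phi> x) \<noteq> 0} \<subseteq> {x. \<phi> x \<noteq> 0}"
    using linear_0[OF bounded_linear.linear[OF h]] by auto
  then have "closure {x. h (\<phi> x) \<noteq> 0} \<subseteq> closure {x. \<phi> x \<noteq> 0}" by (rule closure_mono)
  moreover from this have "compact (closure {x. h (\<phi> x) \<noteq> 0})"
    using \<phi> unfolding test_fields_def
    by (metis (no_types, lifting) bounded_subset closed_closure compact_eq_bounded_closed mem_Collect_eq)
  ultimately show ?thesis
    using \<phi> times_cont_diff_bounded_linear[OF h] by (auto simp: test_fields_def)
qed

lemma partial_deriv_bounded_linear:
  assumes h: "bounded_linear h" and \<phi>: "\<phi> \<in> test_fields \<Omega>"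
  shows "partial_deriv j (\<lambda>x. h (\<phi> x)) x = h (partial_deriv j \<phi> x)"
proof -
  have "times_cont_diff (Suc 0) \<phi>" using \<phi> by (simp add: test_fields_def)
  then have "((\<lambda>x. h (\<phi> x)) has_derivative (\<lambda>v. h (frechet_derivative \<phi> (at x) v))) (at x)"
    by (intro bounded_linear.has_derivative[OF h] times_cont_diff_Suc_has_derivative)
  then show ?thesis by (simp add: partial_deriv_def frechet_derivative_at[symmetric])
qed

text \<open>Ensures that \<open>curl \<Omega> \<phi>\<close> in the trace condition is a genuine
  weak curl and not an arbitrary choice. Weak partial derivatives combine as in the classical
  formula, because \<open>cross_axis j\<close> maps test fields to test fields.\<close>

lemma H1_subset_H_curl:
  assumes \<Omega>: "open \<Omega>" shows "H1 \<Omega> \<subseteq> H_curl \<Omega>"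
proof
  fix w assume "w \<in> H1 \<Omega>"
  then have w: "w \<in> L2 \<Omega>" and ex: "\<forall>j. \<exists>g. g \<in> L2 \<Omega> \<and> has_weak_partial \<Omega> j w g"
    by (auto simp: H1_def)
  from choice[OF ex]
  obtain g where g: "\<And>j. g j \<in> L2 \<Omega>" "\<And>j. has_weak_partial \<Omega> j w (g j)"
    by blast
  define c where "c = (\<Sum>j\<in>UNIV. (\<lambda>x. cross_axis j (g j x)))"
  have cg: "(\<lambda>x. cross_axis j (g j x)) \<in> L2 \<Omega>" for j
    by (rule L2_cross_axis[OF g(1)])
  have "L2_inner \<Omega> w (classical_curl \<phi>) = L2_inner \<Omega> c \<phi>" if \<phi>: "\<phi> \<in> test_fields \<Omega>" for \<phi>
  proof -
    have "L2_inner \<Omega> w (\<lambda>x. cross_axis j (partial_deriv j \<phi> x)) = L2_inner \<Omega> (\<lambda>x. cross_axis j (g j x)) \<phi>" for j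
    proof -
      have "(\<lambda>x. cross_axis j (partial_deriv j \<phi> x)) = partial_deriv j (\<lambda>x. cross_axis j (\<phi> x))"
        using partial_deriv_bounded_linear[OF bounded_linear_cross_axis \<phi>] by (simp add: fun_eq_iff)
      then have "L2_inner \<Omega> w (\<lambda>x. cross_axis j (partial_deriv j \<phi> x)) = - L2_inner \<Omega> (g j) (\<lambda>x. cross_axis j (\<phi> x))"
        using g(2)[of j] test_fields_bounded_linear[OF bounded_linear_cross_axis \<phi>]
        by (simp add: has_weak_partial_def)
      also have "\<dots> = L2_inner \<Omega> (\<lambda>x. cross_axis j (g j x)) \<phi>"
        by (simp add: L2_inner_herm herm_cross_axis)
      finally show ?thesis .
    qed
    then show ?thesis
      unfolding classical_curl_eq c_def using g(1) w \<phi> \<Omega> cg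
      by (simp add: L2_inner_sum_left L2_inner_sum_right L2_cross_axis
          partial_deriv_L2 test_field_L2)
  qed
  then have "has_weak_curl \<Omega> w c" by (simp add: has_weak_curl_def)
  moreover have "c \<in> L2 \<Omega>" unfolding c_def by (intro L2_sum cg)
  ultimately show "w \<in> H_curl \<Omega>" using w by (auto simp: H_curl_def)
qed

section \<open>Uniqueness of weak curls and the linear structure of \<open>H0_curl\<close>\<close>

lemma H_curl_L2: "w \<in> H_curl \<Omega> \<Longrightarrow> w \<in> L2 \<Omega>"
  by (simp add: H_curl_def)

lemma
  assumes "w \<in> H_curl \<Omega>"
  shows curl_L2: "curl \<Omega> w \<in> L2 \<Omega>" and has_weak_curl_curl: "has_weak_curl \<Omega> w (curl \<Omega> w)"
proof -
  have "\<exists>c. c \<in> L2 \<Omega> \<and> has_weak_curl \<Omega> w c" using assms by (auto simp: H_curl_def)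
  then have "curl \<Omega> w \<in> L2 \<Omega> \<and> has_weak_curl \<Omega> w (curl \<Omega> w)"
    unfolding curl_def by (rule someI_ex)
  then show "curl \<Omega> w \<in> L2 \<Omega>" "has_weak_curl \<Omega> w (curl \<Omega> w)" by auto
qed

lemma curl_unique:
  assumes \<Omega>: "open \<Omega>" and w: "w \<in> L2 \<Omega>" and c: "c \<in> L2 \<Omega>" "has_weak_curl \<Omega> w c"
  shows "AE x in lebesgue_on \<Omega>. curl \<Omega> w x = c x"
proof -
  have wH: "w \<in> H_curl \<Omega>" using w c by (auto simp: H_curl_def)
  note C = curl_L2[OF wH] has_weak_curl_curl[OF wH]
  have "AE x in lebesgue_on \<Omega>. (curl \<Omega> w - c) x = 0"
  proof (rule orthogonal_test_fields_imp_AE_zero[OF \<Omega>])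
    show "curl \<Omega> w - c \<in> L2 \<Omega>" using C c by (intro L2_diff)
    show "L2_inner \<Omega> (curl \<Omega> w - c) \<phi> = 0" if "\<phi> \<in> test_fields \<Omega>" for \<phi>
      using that C c test_field_L2[OF that \<Omega>] by (simp add: L2_inner_diff_left has_weak_curl_def)
  qed
  then show ?thesis by eventually_elim simp
qed

lemma has_weak_curl_add:
  assumes "open \<Omega>" "v \<in> L2 \<Omega>" "w \<in> L2 \<Omega>" "c \<in> L2 \<Omega>" "d \<in> L2 \<Omega>" "has_weak_curl \<Omega> v c" "has_weak_curl \<Omega> w d"
  shows "has_weak_curl \<Omega> (v + w) (c + d)"
  using assms by (auto simp: has_weak_curl_def L2_inner_add_left classical_curl_L2 test_field_L2)

lemma has_weak_curl_smult:
  assumes "has_weak_curl \<Omega> v c"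
  shows "has_weak_curl \<Omega> (\<lambda>x. z *s v x) (\<lambda>x. z *s c x)"
  using assms by (auto simp: has_weak_curl_def L2_inner_smult_left)

lemma H0_curl_H_curl: "w \<in> H0_curl \<Omega> \<Longrightarrow> w \<in> H_curl \<Omega>"
  by (simp add: H0_curl_def)

lemma H0_curl_trace:
  "w \<in> H0_curl \<Omega> \<Longrightarrow> \<phi> \<in> H1 \<Omega> \<Longrightarrow> L2_inner \<Omega> w (curl \<Omega> \<phi>) = L2_inner \<Omega> (curl \<Omega> w) \<phi>"
  by (simp add: H0_curl_def tangential_trace_def)

lemma H0_curl_L2: "w \<in> H0_curl \<Omega> \<Longrightarrow> w \<in> L2 \<Omega>"
  and H0_curl_curl_L2: "w \<in> H0_curl \<Omega> \<Longrightarrow> curl \<Omega> w \<in> L2 \<Omega>"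
  and H0_curl_weak: "w \<in> H0_curl \<Omega> \<Longrightarrow> has_weak_curl \<Omega> w (curl \<Omega> w)"
  by (auto dest!: H0_curl_H_curl intro: H_curl_L2 curl_L2 has_weak_curl_curl)

lemma H1_L2: "\<phi> \<in> H1 \<Omega> \<Longrightarrow> \<phi> \<in> L2 \<Omega>"
  by (simp add: H1_def)

text \<open>Pairings do not see null sets, so the trace condition may be checked with any weak curl
  at hand instead of the selected representative.\<close>

lemma H0_curlI:
  assumes \<Omega>: "open \<Omega>" and w: "w \<in> L2 \<Omega>" and c: "c \<in> L2 \<Omega>" "has_weak_curl \<Omega> w c"
    and trace: "\<And>\<phi>. \<phi> \<in> H1 \<Omega> \<Longrightarrow> L2_inner \<Omega> w (curl \<Omega> \<phi>) = L2_inner \<Omega> c \<phi>"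
  shows "w \<in> H0_curl \<Omega>"
proof -
  have wH: "w \<in> H_curl \<Omega>" using w c by (auto simp: H_curl_def)
  have "L2_inner \<Omega> (curl \<Omega> w) \<phi> = L2_inner \<Omega> c \<phi>" if "\<phi> \<in> H1 \<Omega>" for \<phi>
    using that c curl_L2[OF wH] curl_unique[OF \<Omega> w c] by (intro L2_inner_cong_AE) (auto simp: H1_L2)
  then show ?thesis using wH trace by (auto simp: H0_curl_def tangential_trace_def)
qed

lemma H0_curl_add:
  assumes \<Omega>: "open \<Omega>" and v: "v \<in> H0_curl \<Omega>" and w: "w \<in> H0_curl \<Omega>"
  shows "v + w \<in> H0_curl \<Omega>"
proof (rule H0_curlI[OF \<Omega>])
  note [simp] = H0_curl_L2[OF v] H0_curl_L2[OF w] H0_curl_curl_L2[OF v] H0_curl_curl_L2[OF w]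
  show "v + w \<in> L2 \<Omega>" "curl \<Omega> v + curl \<Omega> w \<in> L2 \<Omega>" by (simp_all add: L2_add)
  show "has_weak_curl \<Omega> (v + w) (curl \<Omega> v + curl \<Omega> w)"
    by (rule has_weak_curl_add[OF \<Omega>]) (simp_all add: H0_curl_weak v w)
  show "L2_inner \<Omega> (v + w) (curl \<Omega> \<phi>) = L2_inner \<Omega> (curl \<Omega> v + curl \<Omega> w) \<phi>" if "\<phi> \<in> H1 \<Omega>" for \<phi>
    using that H0_curl_trace[OF v that] H0_curl_trace[OF w that] H1_L2[OF that]
      curl_L2[of \<phi> \<Omega>] H1_subset_H_curl[OF \<Omega>]
    by (auto simp: L2_inner_add_left)
qed

lemma H0_curl_smult:
  assumes \<Omega>: "open \<Omega>" and v: "v \<in> H0_curl \<Omega>"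
  shows "(\<lambda>x. z *s v x) \<in> H0_curl \<Omega>"
  by (rule H0_curlI[OF \<Omega>, where c = "\<lambda>x. z *s curl \<Omega> v x"])
    (use v in \<open>auto simp: L2_smult H0_curl_L2 H0_curl_curl_L2 has_weak_curl_smult H0_curl_weak
      L2_inner_smult_left H0_curl_trace\<close>)

lemma curl_add_AE:
  assumes \<Omega>: "open \<Omega>" and "v \<in> H_curl \<Omega>" "w \<in> H_curl \<Omega>"
  shows "AE x in lebesgue_on \<Omega>. curl \<Omega> (v + w) x = (curl \<Omega> v + curl \<Omega> w) x"
  using assms by (intro curl_unique has_weak_curl_add L2_add) (auto intro: H_curl_L2 curl_L2 has_weak_curl_curl)

lemma curl_smult_AE:
  assumes \<Omega>: "open \<Omega>" and "v \<in> H_curl \<Omega>"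
  shows "AE x in lebesgue_on \<Omega>. curl \<Omega> (\<lambda>x. z *s v x) x = z *s curl \<Omega> v x"
  using assms by (intro curl_unique has_weak_curl_smult L2_smult) (auto intro: H_curl_L2 curl_L2 has_weak_curl_curl)

lemma subspace_H0_curl:
  assumes \<Omega>: "open \<Omega>" shows "subspace (H0_curl \<Omega>)"
proof (rule subspaceI)
  show "0 \<in> H0_curl \<Omega>"
    by (rule H0_curlI[OF \<Omega> L2_zero L2_zero]) (auto simp: has_weak_curl_def L2_inner_def)
qed (use \<Omega> in \<open>auto simp: H0_curl_add H0_curl_smult scaleR_eq_smult\<close>)

lemma H0_curl_diff: "open \<Omega> \<Longrightarrow> v \<in> H0_curl \<Omega> \<Longrightarrow> w \<in> H0_curl \<Omega> \<Longrightarrow> v - w \<in> H0_curl \<Omega>"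
  using subspace_H0_curl by (rule subspace_diff)

lemma curl_diff_AE:
  assumes \<Omega>: "open \<Omega>" and "v \<in> H0_curl \<Omega>" "w \<in> H0_curl \<Omega>"
  shows "AE x in lebesgue_on \<Omega>. curl \<Omega> (v - w) x = (curl \<Omega> v - curl \<Omega> w) x"
proof -
  have "v - w + w = v" by (simp add: fun_eq_iff)
  then have "AE x in lebesgue_on \<Omega>. curl \<Omega> v x = (curl \<Omega> (v - w) + curl \<Omega> w) x"
    using curl_add_AE[OF \<Omega>, of "v - w" w] assms H0_curl_diff[OF assms] by (simp add: H0_curl_H_curl)
  then show ?thesis by eventually_elim simp
qed

lemma tendsto_L2_inner_left:
  assumes "\<And>n. X n \<in> L2 \<Omega>" "x \<in> L2 \<Omega>" "w \<in> L2 \<Omega>" "(\<lambda>n. L2_norm \<Omega> (X n - x)) \<longlonglongrightarrow> 0"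
  shows "(\<lambda>n. L2_inner \<Omega> (X n) w) \<longlonglongrightarrow> L2_inner \<Omega> x w"
proof (rule LIM_zero_cancel, rule Lim_null_comparison)
  show "\<forall>\<^sub>F n in sequentially. norm (L2_inner \<Omega> (X n) w - L2_inner \<Omega> x w) \<le> L2_norm \<Omega> (X n - x) * L2_norm \<Omega> w"
  proof (intro always_eventually allI)
    show "norm (L2_inner \<Omega> (X n) w - L2_inner \<Omega> x w) \<le> L2_norm \<Omega> (X n - x) * L2_norm \<Omega> w" for n
      using L2_Cauchy_Schwarz[OF L2_diff[OF assms(1)[of n] assms(2)] assms(3)] assms(1-3)
      by (simp add: L2_inner_diff_left)
  qed
  show "(\<lambda>n. L2_norm \<Omega> (X n - x) * L2_norm \<Omega> w) \<longlonglongrightarrow> 0"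
    by (intro tendsto_mult_left_zero assms)
qed

text \<open>Weak curl and zero trace have the common shape
  \<open>L2_inner \<Omega> x v = L2_inner \<Omega> c w\<close> with fixed square integrable
  \<open>v\<close> and \<open>w\<close>, and such identities pass to the limit by continuity of the
  pairing.\<close>

lemma H0_curl_closed:
  assumes \<Omega>: "open \<Omega>" and X: "\<And>n. X n \<in> H0_curl \<Omega>" and x: "x \<in> L2 \<Omega>" and c: "c \<in> L2 \<Omega>"
    and lim: "(\<lambda>n. L2_norm \<Omega> (X n - x)) \<longlonglongrightarrow> 0" and limc: "(\<lambda>n. L2_norm \<Omega> (curl \<Omega> (X n) - c)) \<longlonglongrightarrow> 0"
  shows "x \<in> H0_curl \<Omega> \<and> (AE t in lebesgue_on \<Omega>. curl \<Omega> x t = c t)"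
proof -
  note L = H0_curl_L2[OF X] H0_curl_curl_L2[OF X]
  have eq: "L2_inner \<Omega> x v = L2_inner \<Omega> c w"
    if "v \<in> L2 \<Omega>" "w \<in> L2 \<Omega>" "\<And>n. L2_inner \<Omega> (X n) v = L2_inner \<Omega> (curl \<Omega> (X n)) w" for v w
    using tendsto_L2_inner_left[OF L(1) x that(1) lim] tendsto_L2_inner_left[OF L(2) c that(2) limc]
    unfolding that(3) by (rule LIMSEQ_unique)
  have weak: "has_weak_curl \<Omega> x c"
    unfolding has_weak_curl_def
    using H0_curl_weak[OF X] classical_curl_L2 test_field_L2 \<Omega> by (auto intro!: eq simp: has_weak_curl_def)
  have "L2_inner \<Omega> x (curl \<Omega> \<phi>) = L2_inner \<Omega> c \<phi>" if "\<phi> \<in> H1 \<Omega>" for \<phi>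
    using H1_subset_H_curl[OF \<Omega>] that by (intro eq H0_curl_trace X) (auto intro: curl_L2 H1_L2)
  then show ?thesis using H0_curlI[OF \<Omega> x c weak] curl_unique[OF \<Omega> x c weak] by blast
qed

section \<open>The graph inner product and completeness of \<open>H0_curl\<close>\<close>

definition graph_inner :: "(real^3) set \<Rightarrow> field \<Rightarrow> field \<Rightarrow> real" where
  "graph_inner \<Omega> v w = Re (L2_inner \<Omega> v w) + Re (L2_inner \<Omega> (curl \<Omega> v) (curl \<Omega> w))"

lemma graph_inner_self: "graph_inner \<Omega> v v = (L2_norm \<Omega> v)\<^sup>2 + (L2_norm \<Omega> (curl \<Omega> v))\<^sup>2"
  by (simp add: graph_inner_def L2_inner_self)

lemma L2_inner_curl_add_left:
  assumes "open \<Omega>" "v \<in> H0_curl \<Omega>" "w \<in> H0_curl \<Omega>" "u \<in> L2 \<Omega>"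
  shows "L2_inner \<Omega> (curl \<Omega> (v + w)) u = L2_inner \<Omega> (curl \<Omega> v) u + L2_inner \<Omega> (curl \<Omega> w) u"
proof -
  have "L2_inner \<Omega> (curl \<Omega> (v + w)) u = L2_inner \<Omega> (curl \<Omega> v + curl \<Omega> w) u"
    using assms curl_add_AE[of \<Omega> v w]
    by (intro L2_inner_cong_AE) (auto intro!: L2_add H0_curl_curl_L2 H0_curl_add dest: H0_curl_H_curl)
  then show ?thesis using assms by (simp add: L2_inner_add_left H0_curl_curl_L2)
qed

lemma L2_inner_curl_smult_left:
  assumes "open \<Omega>" "v \<in> H0_curl \<Omega>" "u \<in> L2 \<Omega>"
  shows "L2_inner \<Omega> (curl \<Omega> (\<lambda>x. z *s v x)) u = z * L2_inner \<Omega> (curl \<Omega> v) u"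
proof -
  have "L2_inner \<Omega> (curl \<Omega> (\<lambda>x. z *s v x)) u = L2_inner \<Omega> (\<lambda>x. z *s curl \<Omega> v x) u"
    using assms curl_smult_AE[of \<Omega> v z]
    by (intro L2_inner_cong_AE) (auto intro!: L2_smult H0_curl_curl_L2 H0_curl_smult dest: H0_curl_H_curl)
  then show ?thesis by (simp add: L2_inner_smult_left)
qed

lemma L2_inner_curl_add_right:
  assumes "open \<Omega>" "v \<in> H0_curl \<Omega>" "w \<in> H0_curl \<Omega>" "u \<in> L2 \<Omega>"
  shows "L2_inner \<Omega> u (curl \<Omega> (v + w)) = L2_inner \<Omega> u (curl \<Omega> v) + L2_inner \<Omega> u (curl \<Omega> w)"
  by (subst (1 2 3) L2_inner_commute) (simp add: L2_inner_curl_add_left[OF assms])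

lemma L2_inner_curl_smult_right:
  assumes "open \<Omega>" "v \<in> H0_curl \<Omega>" "u \<in> L2 \<Omega>"
  shows "L2_inner \<Omega> u (curl \<Omega> (\<lambda>x. z *s v x)) = cnj z * L2_inner \<Omega> u (curl \<Omega> v)"
  by (subst (1 2) L2_inner_commute) (simp add: L2_inner_curl_smult_left[OF assms])

lemma graph_norm_diff:
  assumes "open \<Omega>" "v \<in> H0_curl \<Omega>" "w \<in> H0_curl \<Omega>"
  shows "graph_inner \<Omega> (v - w) (v - w) = (L2_norm \<Omega> (v - w))\<^sup>2 + (L2_norm \<Omega> (curl \<Omega> v - curl \<Omega> w))\<^sup>2"
proof -
  have "L2_norm \<Omega> (curl \<Omega> (v - w)) = L2_norm \<Omega> (curl \<Omega> v - curl \<Omega> w)"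
    using assms curl_diff_AE[OF assms] by (intro L2_norm_cong_AE) (auto intro!: H0_curl_curl_L2 H0_curl_diff L2_diff)
  then show ?thesis by (simp add: graph_inner_self)
qed

text \<open>A Cauchy sequence in the graph norm has separate L2 limits of the fields and of the
  curls; closedness identifies the second as the curl of the first.\<close>

lemma semi_hilbert_H0_curl:
  assumes \<Omega>: "open \<Omega>" and m: "\<Omega> \<in> lmeasurable"
  shows "semi_hilbert (H0_curl \<Omega>) (graph_inner \<Omega>)"
proof
  show "subspace (H0_curl \<Omega>)" by (rule subspace_H0_curl[OF \<Omega>])
  fix x y z :: field and r :: real
  assume H: "x \<in> H0_curl \<Omega>" "z \<in> H0_curl \<Omega>"
  show "graph_inner \<Omega> (r *\<^sub>R x) z = r * graph_inner \<Omega> x z"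
    using H \<Omega> by (simp add: graph_inner_def scaleR_eq_smult L2_inner_smult_left L2_inner_curl_smult_left
        H0_curl_curl_L2 algebra_simps)
  assume "y \<in> H0_curl \<Omega>"
  with H \<Omega> show "graph_inner \<Omega> (x + y) z = graph_inner \<Omega> x z + graph_inner \<Omega> y z"
    by (simp add: graph_inner_def L2_inner_add_left L2_inner_curl_add_left H0_curl_L2 H0_curl_curl_L2)
next
  show "graph_inner \<Omega> x y = graph_inner \<Omega> y x" for x y
    unfolding graph_inner_def by (subst (1 2) L2_inner_commute) simp
  show "0 \<le> graph_inner \<Omega> x x" for x by (simp add: graph_inner_self)
next
  fix X :: "nat \<Rightarrow> field"
  assume X: "\<And>n. X n \<in> H0_curl \<Omega>"
    and C: "\<And>e. e > 0 \<Longrightarrow> \<exists>N. \<forall>m\<ge>N. \<forall>n\<ge>N. graph_inner \<Omega> (X m - X n) (X m - X n) < e"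
  have small: "L2_norm \<Omega> (X m - X n) < e \<and> L2_norm \<Omega> (curl \<Omega> (X m) - curl \<Omega> (X n)) < e"
    if "graph_inner \<Omega> (X m - X n) (X m - X n) < e\<^sup>2" "e > 0" for m n e
  proof -
    have "(L2_norm \<Omega> (X m - X n))\<^sup>2 + (L2_norm \<Omega> (curl \<Omega> (X m) - curl \<Omega> (X n)))\<^sup>2 < e\<^sup>2"
      using that(1) unfolding graph_norm_diff[OF \<Omega> X X] .
    then have "(L2_norm \<Omega> (X m - X n))\<^sup>2 < e\<^sup>2" "(L2_norm \<Omega> (curl \<Omega> (X m) - curl \<Omega> (X n)))\<^sup>2 < e\<^sup>2"
      by (smt (verit) zero_le_power2)+
    then show ?thesis using that(2) by (meson less_imp_le power2_less_imp_less)
  qed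
  have both: "\<exists>N. \<forall>m\<ge>N. \<forall>n\<ge>N. L2_norm \<Omega> (X m - X n) < e \<and> L2_norm \<Omega> (curl \<Omega> (X m) - curl \<Omega> (X n)) < e"
    if e: "e > 0" for e
  proof -
    obtain N where "\<forall>m\<ge>N. \<forall>n\<ge>N. graph_inner \<Omega> (X m - X n) (X m - X n) < e\<^sup>2"
      using C[of "e\<^sup>2"] e by auto
    then have "\<forall>m\<ge>N. \<forall>n\<ge>N. L2_norm \<Omega> (X m - X n) < e \<and> L2_norm \<Omega> (curl \<Omega> (X m) - curl \<Omega> (X n)) < e"
      using small e by blast
    then show ?thesis ..
  qed
  have "\<exists>x\<in>L2 \<Omega>. (\<lambda>n. L2_norm \<Omega> (X n - x)) \<longlonglongrightarrow> 0"
    by (rule L2_complete[OF m H0_curl_L2[OF X]]) (use both in blast)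
  then obtain x where x: "x \<in> L2 \<Omega>" "(\<lambda>n. L2_norm \<Omega> (X n - x)) \<longlonglongrightarrow> 0" by blast
  have "\<exists>c\<in>L2 \<Omega>. (\<lambda>n. L2_norm \<Omega> (curl \<Omega> (X n) - c)) \<longlonglongrightarrow> 0"
    by (rule L2_complete[OF m H0_curl_curl_L2[OF X]]) (use both in blast)
  then obtain c where c: "c \<in> L2 \<Omega>" "(\<lambda>n. L2_norm \<Omega> (curl \<Omega> (X n) - c)) \<longlonglongrightarrow> 0" by blast
  have xH: "x \<in> H0_curl \<Omega>" and cx: "AE t in lebesgue_on \<Omega>. curl \<Omega> x t = c t"
    using H0_curl_closed[OF \<Omega> X x(1) c(1) x(2) c(2)] by auto
  have eq: "L2_norm \<Omega> (curl \<Omega> (X n) - curl \<Omega> x) = L2_norm \<Omega> (curl \<Omega> (X n) - c)" for n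
    using cx by (intro L2_norm_cong_AE L2_diff H0_curl_curl_L2 X xH c) (auto elim!: eventually_mono)
  have "(\<lambda>n. graph_inner \<Omega> (X n - x) (X n - x)) \<longlonglongrightarrow> 0\<^sup>2 + 0\<^sup>2"
    unfolding graph_norm_diff[OF \<Omega> X xH] eq by (intro tendsto_intros x(2) c(2))
  then show "\<exists>l\<in>H0_curl \<Omega>. (\<lambda>n. graph_inner \<Omega> (X n - l) (X n - l)) \<longlonglongrightarrow> 0" using xH by auto
qed

subsection \<open>The state equation\<close>

lemma herm_smult_swap: "herm (c *s v) w = herm v (cnj c *s w)"
  by (simp add: herm_smult_left herm_smult_right)

text \<open>With the coefficient moved to the second factor, the additivity rules for pairings with
  \<open>curl\<close> apply, although \<open>curl\<close> itself is additive only almost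
  everywhere.\<close>

lemma L2_inner_mult_swap: "L2_inner \<Omega> (\<lambda>x. g x *s v x) w = L2_inner \<Omega> v (\<lambda>x. cnj (g x) *s w x)"
  by (simp add: L2_inner_herm herm_smult_swap)

text \<open>For equal arguments the integrand is \<open>z * g x\<close> times the real number
  \<open>(norm (v x))\<^sup>2\<close>, so a pointwise bound on \<open>Re (z * g x)\<close>
  integrates.\<close>

lemma L2_inner_mult_self_ge:
  assumes v: "v \<in> L2 \<Omega>" and g: "g \<in> borel_measurable (lebesgue_on \<Omega>)"
    and bound: "AE x in lebesgue_on \<Omega>. norm (g x) \<le> C"
    and lower: "AE x in lebesgue_on \<Omega>. k \<le> Re (z * g x)"
  shows "k * (L2_norm \<Omega> v)\<^sup>2 \<le> Re (z * L2_inner \<Omega> (\<lambda>x. g x *s v x) v)"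
proof -
  have int: "integrable (lebesgue_on \<Omega>) (\<lambda>x. z * herm (g x *s v x) (v x))"
    using integrable_herm[OF L2_mult_bounded[OF v g bound] v] by simp
  have "k * (L2_norm \<Omega> v)\<^sup>2 = (LINT x|lebesgue_on \<Omega>. k * (norm (v x))\<^sup>2)"
    by (simp add: L2_norm_def integral_nonneg_AE)
  also have "\<dots> \<le> (LINT x|lebesgue_on \<Omega>. Re (z * herm (g x *s v x) (v x)))"
  proof (rule integral_mono_AE)
    show "AE x in lebesgue_on \<Omega>. k * (norm (v x))\<^sup>2 \<le> Re (z * herm (g x *s v x) (v x))"
    proof (use lower in eventually_elim)
      fix x assume "k \<le> Re (z * g x)"
      then have "k * (norm (v x))\<^sup>2 \<le> Re (z * g x) * (norm (v x))\<^sup>2" by (rule mult_right_mono) simp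
      also have "\<dots> = Re (z * herm (g x *s v x) (v x))"
        by (simp add: herm_smult_left herm_self algebra_simps del: of_real_power)
      finally show "k * (norm (v x))\<^sup>2 \<le> Re (z * herm (g x *s v x) (v x))" .
    qed
  qed (use L2_integrable[OF v] integrable_Re[OF int] in \<open>simp_all del: times_complex.sel\<close>)
  also have "\<dots> = Re (z * L2_inner \<Omega> (\<lambda>x. g x *s v x) v)"
    using integral_Re[OF int] by (simp add: L2_inner_herm)
  finally show ?thesis .
qed

text \<open>\<open>\<nu>\<close> plays the role of the inverse of \<open>\<mu>\<close>. The
  constants \<open>C\<close>, \<open>M\<close> and \<open>m\<close> are to bound every coefficient
  \<open>\<kappa>\<close> arising from a control; fixing them in the locale makes all estimates
  below uniform in the control.\<close>

locale maxwell =
  fixes \<Omega> :: "(real^3) set" and \<nu> :: "real^3 \<Rightarrow> complex" and \<omega> \<nu>min \<nu>max C M m :: real and f :: field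
  assumes open_domain: "open \<Omega>" and lmeasurable_domain: "\<Omega> \<in> lmeasurable"
    and \<omega>: "\<omega> > 0"
    and \<nu>_measurable: "\<nu> \<in> borel_measurable (lebesgue_on \<Omega>)"
    and \<nu>_bound: "AE x in lebesgue_on \<Omega>. norm (\<nu> x) \<le> \<nu>max"
    and \<nu>_lower: "AE x in lebesgue_on \<Omega>. Im (\<nu> x) = 0 \<and> \<nu>min \<le> Re (\<nu> x)" "\<nu>min > 0"
    and M: "M \<ge> 0" and m: "m > 0"
    and f: "f \<in> L2 \<Omega>"
begin

definition admissible :: "(real^3 \<Rightarrow> complex) \<Rightarrow> bool" where
  "admissible \<kappa> \<longleftrightarrow> \<kappa> \<in> borel_measurable (lebesgue_on \<Omega>) \<and>
     (AE x in lebesgue_on \<Omega>. norm (\<kappa> x) \<le> C \<and> Re (\<kappa> x) \<le> M \<and> m \<le> Im (\<kappa> x))"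

definition B :: "(real^3 \<Rightarrow> complex) \<Rightarrow> field \<Rightarrow> field \<Rightarrow> complex" where
  "B \<kappa> y w = L2_inner \<Omega> (\<lambda>x. \<nu> x *s curl \<Omega> y x) (curl \<Omega> w)
     - of_real (\<omega>\<^sup>2) * L2_inner \<Omega> (\<lambda>x. \<kappa> x *s y x) w"

text \<open>The real part of \<open>\<theta> B\<close> is coercive: the imaginary part of \<open>B\<close>, which controls the
  \<open>L\<^sup>2\<close> norm through the conductivity, absorbs the negative part of \<open>Re B\<close>.\<close>

definition \<theta> :: complex where "\<theta> = Complex 1 ((M + 1) / m)"

definition coerc :: real where "coerc = min \<nu>min (\<omega>\<^sup>2)"

definition solves :: "(real^3 \<Rightarrow> complex) \<Rightarrow> field \<Rightarrow> bool" where
  "solves \<kappa> y \<longleftrightarrow> y \<in> H0_curl \<Omega> \<and> (\<forall>w\<in>H0_curl \<Omega>. B \<kappa> y w = L2_inner \<Omega> f w)"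

sublocale graph: semi_hilbert "H0_curl \<Omega>" "graph_inner \<Omega>"
  by (rule semi_hilbert_H0_curl[OF open_domain lmeasurable_domain])

lemma coerc_pos: "coerc > 0"
  using \<nu>_lower \<omega> by (simp add: coerc_def)

lemma \<theta>_nonzero: "\<theta> \<noteq> 0"
  by (simp add: \<theta>_def complex_eq_iff)

lemma admissibleD:
  assumes "admissible \<kappa>"
  shows "\<kappa> \<in> borel_measurable (lebesgue_on \<Omega>)" "AE x in lebesgue_on \<Omega>. norm (\<kappa> x) \<le> C"
    "AE x in lebesgue_on \<Omega>. Re (\<kappa> x) \<le> M \<and> m \<le> Im (\<kappa> x)"
  using assms by (auto simp: admissible_def elim!: eventually_mono)

lemma L2_norm_le_graph: "L2_norm \<Omega> v \<le> graph.nrm v" "L2_norm \<Omega> (curl \<Omega> v) \<le> graph.nrm v"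
  by (auto simp: graph.nrm_def graph_inner_self intro!: real_le_rsqrt)

lemma \<nu>_curl_L2: "y \<in> H0_curl \<Omega> \<Longrightarrow> (\<lambda>x. \<nu> x *s curl \<Omega> y x) \<in> L2 \<Omega>"
  by (rule L2_mult_bounded[OF _ \<nu>_measurable \<nu>_bound]) (rule H0_curl_curl_L2)

lemma cnj_\<nu>_curl_L2: "y \<in> H0_curl \<Omega> \<Longrightarrow> (\<lambda>x. cnj (\<nu> x) *s curl \<Omega> y x) \<in> L2 \<Omega>"
  by (rule L2_mult_bounded[where C = \<nu>max])
    (use \<nu>_measurable \<nu>_bound in \<open>auto simp: H0_curl_curl_L2
      intro: borel_measurable_continuous_on[OF continuous_on_cnj[OF continuous_on_id]]\<close>)

lemma \<kappa>_L2: "admissible \<kappa> \<Longrightarrow> y \<in> H0_curl \<Omega> \<Longrightarrow> (\<lambda>x. \<kappa> x *s y x) \<in> L2 \<Omega>"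
  by (rule L2_mult_bounded[OF _ admissibleD(1,2)]) (auto intro: H0_curl_L2)

lemma B_add_left:
  assumes \<kappa>: "admissible \<kappa>" and "x \<in> H0_curl \<Omega>" "y \<in> H0_curl \<Omega>" "w \<in> H0_curl \<Omega>"
  shows "B \<kappa> (x + y) w = B \<kappa> x w + B \<kappa> y w"
proof -
  have "(\<lambda>t. \<kappa> t *s (x + y) t) = (\<lambda>t. \<kappa> t *s x t) + (\<lambda>t. \<kappa> t *s y t)"
    by (simp add: fun_eq_iff vec_eq_iff distrib_left)
  then have "L2_inner \<Omega> (\<lambda>t. \<kappa> t *s (x + y) t) w
      = L2_inner \<Omega> (\<lambda>t. \<kappa> t *s x t) w + L2_inner \<Omega> (\<lambda>t. \<kappa> t *s y t) w"
    using assms by (simp only: L2_inner_add_left \<kappa>_L2 H0_curl_L2)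
  moreover have "L2_inner \<Omega> (\<lambda>t. \<nu> t *s curl \<Omega> (x + y) t) (curl \<Omega> w)
      = L2_inner \<Omega> (\<lambda>t. \<nu> t *s curl \<Omega> x t) (curl \<Omega> w) + L2_inner \<Omega> (\<lambda>t. \<nu> t *s curl \<Omega> y t) (curl \<Omega> w)"
    unfolding L2_inner_mult_swap using assms open_domain
    by (intro L2_inner_curl_add_left cnj_\<nu>_curl_L2)
  ultimately show ?thesis by (simp add: B_def algebra_simps)
qed

lemma B_add_right:
  assumes \<kappa>: "admissible \<kappa>" and "x \<in> H0_curl \<Omega>" "y \<in> H0_curl \<Omega>" "w \<in> H0_curl \<Omega>"
  shows "B \<kappa> w (x + y) = B \<kappa> w x + B \<kappa> w y"
  using assms open_domain
  by (simp add: B_def L2_inner_add_right L2_inner_curl_add_right \<nu>_curl_L2 \<kappa>_L2 H0_curl_L2 algebra_simps)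

lemma B_smult_left:
  assumes "x \<in> H0_curl \<Omega>" "w \<in> H0_curl \<Omega>"
  shows "B \<kappa> (\<lambda>t. z *s x t) w = z * B \<kappa> x w"
proof -
  have "L2_inner \<Omega> (\<lambda>t. \<kappa> t *s (z *s x t)) w = z * L2_inner \<Omega> (\<lambda>t. \<kappa> t *s x t) w"
    unfolding L2_inner_smult_left[symmetric] by (simp add: vector_smult_assoc mult.commute)
  moreover have "L2_inner \<Omega> (\<lambda>t. \<nu> t *s curl \<Omega> (\<lambda>t. z *s x t) t) (curl \<Omega> w)
      = z * L2_inner \<Omega> (\<lambda>t. \<nu> t *s curl \<Omega> x t) (curl \<Omega> w)"
    unfolding L2_inner_mult_swap using assms open_domain
    by (intro L2_inner_curl_smult_left cnj_\<nu>_curl_L2)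
  ultimately show ?thesis by (simp add: B_def algebra_simps)
qed

lemma B_smult_right:
  assumes "x \<in> H0_curl \<Omega>" "w \<in> H0_curl \<Omega>"
  shows "B \<kappa> w (\<lambda>t. z *s x t) = cnj z * B \<kappa> w x"
  using assms open_domain
  by (simp add: B_def L2_inner_smult_right L2_inner_curl_smult_right \<nu>_curl_L2 algebra_simps)

lemma B_diff_left:
  assumes \<kappa>: "admissible \<kappa>" and "x \<in> H0_curl \<Omega>" "y \<in> H0_curl \<Omega>" "w \<in> H0_curl \<Omega>"
  shows "B \<kappa> (x - y) w = B \<kappa> x w - B \<kappa> y w"
proof -
  have "x - y + y = x" by (simp add: fun_eq_iff)
  then show ?thesis
    using B_add_left[OF \<kappa> H0_curl_diff[OF open_domain assms(2,3)] assms(3,4)] by simp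
qed

lemma B_bound:
  assumes \<kappa>: "admissible \<kappa>" and y: "y \<in> H0_curl \<Omega>" and w: "w \<in> H0_curl \<Omega>"
  shows "norm (B \<kappa> y w) \<le> (max 0 \<nu>max + \<omega>\<^sup>2 * max 0 C) * graph.nrm y * graph.nrm w"
proof -
  have est: "norm (L2_inner \<Omega> (\<lambda>x. g x *s v x) u) \<le> max 0 D * graph.nrm y * graph.nrm w"
    if v: "v \<in> L2 \<Omega>" and u: "u \<in> L2 \<Omega>" and g: "g \<in> borel_measurable (lebesgue_on \<Omega>)"
      and bound: "AE x in lebesgue_on \<Omega>. norm (g x) \<le> D"
      and le: "L2_norm \<Omega> v \<le> graph.nrm y" "L2_norm \<Omega> u \<le> graph.nrm w" for v u g D
  proof -
    \<comment> \<open>The locale prescribes no sign for \<open>\<nu>max\<close> and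
      \<open>C\<close>, while the norm estimate for products asks for a nonnegative factor.\<close>
    have bound': "AE x in lebesgue_on \<Omega>. norm (g x) \<le> max 0 D"
      using bound by eventually_elim simp
    have "norm (L2_inner \<Omega> (\<lambda>x. g x *s v x) u) \<le> L2_norm \<Omega> (\<lambda>x. g x *s v x) * L2_norm \<Omega> u"
      by (rule L2_Cauchy_Schwarz[OF L2_mult_bounded[OF v g bound] u])
    also have "\<dots> \<le> (max 0 D * L2_norm \<Omega> v) * L2_norm \<Omega> u"
      by (intro mult_right_mono L2_norm_mult_bounded[OF v g bound']) auto
    also have "\<dots> \<le> (max 0 D * graph.nrm y) * graph.nrm w"
      using graph.nrm_ge_0[OF y] by (intro mult_mono mult_left_mono le mult_nonneg_nonneg) auto
    finally show ?thesis .
  qed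
  have 1: "norm (L2_inner \<Omega> (\<lambda>x. \<nu> x *s curl \<Omega> y x) (curl \<Omega> w)) \<le> max 0 \<nu>max * graph.nrm y * graph.nrm w"
    using y w by (intro est H0_curl_curl_L2 \<nu>_measurable \<nu>_bound L2_norm_le_graph)
  have 2: "norm (L2_inner \<Omega> (\<lambda>x. \<kappa> x *s y x) w) \<le> max 0 C * graph.nrm y * graph.nrm w"
    using y w by (intro est H0_curl_L2 admissibleD[OF \<kappa>] L2_norm_le_graph)
  have "norm (B \<kappa> y w) \<le> norm (L2_inner \<Omega> (\<lambda>x. \<nu> x *s curl \<Omega> y x) (curl \<Omega> w))
      + \<omega>\<^sup>2 * norm (L2_inner \<Omega> (\<lambda>x. \<kappa> x *s y x) w)"
    unfolding B_def by (rule order_trans[OF norm_triangle_ineq4]) (simp add: norm_mult norm_power)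
  also have "\<dots> \<le> max 0 \<nu>max * graph.nrm y * graph.nrm w + \<omega>\<^sup>2 * (max 0 C * graph.nrm y * graph.nrm w)"
    by (intro add_mono 1 mult_left_mono 2) simp
  finally show ?thesis by (simp add: algebra_simps)
qed

lemma B_coercive:
  assumes \<kappa>: "admissible \<kappa>" and y: "y \<in> H0_curl \<Omega>"
  shows "coerc * graph_inner \<Omega> y y \<le> Re (\<theta> * B \<kappa> y y)"
proof -
  \<comment> \<open>\<open>\<nu>\<close> is real almost everywhere and \<open>\<theta>\<close> has
    real part 1, so \<open>Re (\<theta> * \<nu> x)\<close> is \<open>Re (\<nu> x)\<close>.\<close>
  have "\<nu>min * (L2_norm \<Omega> (curl \<Omega> y))\<^sup>2 \<le> Re (\<theta> * L2_inner \<Omega> (\<lambda>x. \<nu> x *s curl \<Omega> y x) (curl \<Omega> y))"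
    by (rule L2_inner_mult_self_ge[OF H0_curl_curl_L2[OF y] \<nu>_measurable \<nu>_bound])
      (use \<nu>_lower(1) in \<open>eventually_elim, simp add: \<theta>_def\<close>)
  moreover have "\<omega>\<^sup>2 * (L2_norm \<Omega> y)\<^sup>2 \<le> Re ((- of_real (\<omega>\<^sup>2) * \<theta>) * L2_inner \<Omega> (\<lambda>x. \<kappa> x *s y x) y)"
  proof (rule L2_inner_mult_self_ge[OF H0_curl_L2[OF y] admissibleD(1,2)[OF \<kappa>]])
    show "AE x in lebesgue_on \<Omega>. \<omega>\<^sup>2 \<le> Re (- of_real (\<omega>\<^sup>2) * \<theta> * \<kappa> x)"
    proof (use admissibleD(3)[OF \<kappa>] in eventually_elim)
      fix x assume x: "Re (\<kappa> x) \<le> M \<and> m \<le> Im (\<kappa> x)"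
      \<comment> \<open>The origin of \<open>\<theta>\<close>: its imaginary part
        \<open>(M + 1) / m\<close> outweighs the bound \<open>M\<close> on the real part by exactly
        1, whence \<open>Re (\<theta> * \<kappa> x) \<le> M - (M + 1)\<close>.\<close>
      have "(M + 1) / m * m \<le> (M + 1) / m * Im (\<kappa> x)"
        using x M m by (intro mult_left_mono) auto
      then have "Re (\<theta> * \<kappa> x) \<le> - 1" using x m by (simp add: \<theta>_def)
      then have "\<omega>\<^sup>2 * 1 \<le> \<omega>\<^sup>2 * - Re (\<theta> * \<kappa> x)" by (intro mult_left_mono) auto
      also have "\<dots> = Re (- of_real (\<omega>\<^sup>2) * \<theta> * \<kappa> x)"
        by (simp add: algebra_simps del: of_real_power)
      finally show "\<omega>\<^sup>2 \<le> Re (- of_real (\<omega>\<^sup>2) * \<theta> * \<kappa> x)" by simp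
    qed
  qed
  ultimately have "\<nu>min * (L2_norm \<Omega> (curl \<Omega> y))\<^sup>2 + \<omega>\<^sup>2 * (L2_norm \<Omega> y)\<^sup>2 \<le> Re (\<theta> * B \<kappa> y y)"
    by (simp add: B_def algebra_simps)
  moreover have "coerc * (L2_norm \<Omega> (curl \<Omega> y))\<^sup>2 \<le> \<nu>min * (L2_norm \<Omega> (curl \<Omega> y))\<^sup>2"
    "coerc * (L2_norm \<Omega> y)\<^sup>2 \<le> \<omega>\<^sup>2 * (L2_norm \<Omega> y)\<^sup>2"
    by (auto simp: coerc_def intro!: mult_right_mono)
  ultimately show ?thesis by (simp add: graph_inner_self algebra_simps)
qed

text \<open>The real Lax-Milgram theorem is applied to \<open>\<theta>\<close> times both sides of
  the equation. Both sides are conjugate linear in the test field, which recovers the complex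
  identity; there the nonzero factor \<open>\<theta>\<close> cancels.\<close>

lemma ex_solution:
  assumes \<kappa>: "admissible \<kappa>" shows "\<exists>y. solves \<kappa> y"
proof -
  define b where "b y w = Re (\<theta> * B \<kappa> y w)" for y w
  define F where "F w = Re (\<theta> * L2_inner \<Omega> f w)" for w
  have "\<exists>y\<in>H0_curl \<Omega>. \<forall>w\<in>H0_curl \<Omega>. b y w = F w"
  proof (rule graph.Lax_Milgram)
    show "coerc > 0" by (rule coerc_pos)
    show "coerc * graph_inner \<Omega> x x \<le> b x x" if "x \<in> H0_curl \<Omega>" for x
      using B_coercive[OF \<kappa> that] by (simp add: b_def)
    fix x assume x: "x \<in> H0_curl \<Omega>"
    show "F (r *\<^sub>R x) = r * F x" for r
      by (simp add: F_def L2_inner_scaleR_right algebra_simps)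
    have "\<bar>F x\<bar> \<le> norm \<theta> * norm (L2_inner \<Omega> f x)"
      unfolding F_def norm_mult[symmetric] by (rule abs_Re_le_cmod)
    also have "\<dots> \<le> norm \<theta> * (L2_norm \<Omega> f * graph.nrm x)"
      using L2_Cauchy_Schwarz[OF f H0_curl_L2[OF x]] L2_norm_le_graph(1)[of x]
      by (intro mult_left_mono order_trans[OF L2_Cauchy_Schwarz[OF f H0_curl_L2[OF x]]]) auto
    finally show "\<bar>F x\<bar> \<le> (norm \<theta> * L2_norm \<Omega> f) * graph.nrm x" by (simp add: mult.assoc)
    fix y assume y: "y \<in> H0_curl \<Omega>"
    show "F (x + y) = F x + F y"
      using f x y by (simp add: F_def L2_inner_add_right H0_curl_L2 distrib_left)
    show "b (r *\<^sub>R x) y = r * b x y" for r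
      unfolding b_def scaleR_eq_smult B_smult_left[OF x y] by (simp add: algebra_simps)
    show "b y (r *\<^sub>R x) = r * b y x" for r
      unfolding b_def scaleR_eq_smult B_smult_right[OF x y] by (simp add: algebra_simps)
    have "\<bar>b x y\<bar> \<le> norm \<theta> * norm (B \<kappa> x y)"
      unfolding b_def norm_mult[symmetric] by (rule abs_Re_le_cmod)
    also have "\<dots> \<le> norm \<theta> * ((max 0 \<nu>max + \<omega>\<^sup>2 * max 0 C) * graph.nrm x * graph.nrm y)"
      by (intro mult_left_mono B_bound[OF \<kappa> x y]) simp
    finally show "\<bar>b x y\<bar> \<le> (norm \<theta> * (max 0 \<nu>max + \<omega>\<^sup>2 * max 0 C)) * graph.nrm x * graph.nrm y"
      by (simp add: mult.assoc)
    fix z assume z: "z \<in> H0_curl \<Omega>"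
    show "b (x + y) z = b x z + b y z"
      unfolding b_def B_add_left[OF \<kappa> x y z] by (simp only: distrib_left plus_complex.sel)
    show "b z (x + y) = b z x + b z y"
      unfolding b_def B_add_right[OF \<kappa> x y z] by (simp only: distrib_left plus_complex.sel)
  qed
  then obtain y where y: "y \<in> H0_curl \<Omega>" and eq: "\<And>w. w \<in> H0_curl \<Omega> \<Longrightarrow> b y w = F w" by blast
  have "B \<kappa> y w = L2_inner \<Omega> f w" if w: "w \<in> H0_curl \<Omega>" for w
  proof -
    have re: "Re (\<theta> * B \<kappa> y w) = Re (\<theta> * L2_inner \<Omega> f w)"
      using eq[OF w] by (simp only: b_def F_def)
    \<comment> \<open>testing with \<open>\<i> w\<close> turns real into imaginary parts\<close>
    have "Re (\<theta> * (cnj \<i> * B \<kappa> y w)) = Re (\<theta> * (cnj \<i> * L2_inner \<Omega> f w))"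
      using eq[OF H0_curl_smult[OF open_domain w, of \<i>]]
      unfolding b_def F_def B_smult_right[OF w y] L2_inner_smult_right .
    then have "Im (\<theta> * B \<kappa> y w) = Im (\<theta> * L2_inner \<Omega> f w)" by (simp add: algebra_simps)
    with re have "\<theta> * B \<kappa> y w = \<theta> * L2_inner \<Omega> f w" by (rule complex_eqI)
    then show ?thesis using \<theta>_nonzero by simp
  qed
  then show ?thesis using y by (auto simp: solves_def)
qed

text \<open>Coercivity tested with the solution itself. The bound is independent of
  \<open>\<kappa>\<close>, as the stability estimate requires.\<close>

lemma solution_bound:
  assumes \<kappa>: "admissible \<kappa>" and y: "solves \<kappa> y"
  shows "L2_norm \<Omega> y \<le> norm \<theta> * L2_norm \<Omega> f / coerc"
proof -
  have yH: "y \<in> H0_curl \<Omega>" using y by (simp add: solves_def)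
  have "coerc * (L2_norm \<Omega> y)\<^sup>2 \<le> coerc * graph_inner \<Omega> y y"
    using coerc_pos by (intro mult_left_mono) (auto simp: graph_inner_self)
  also have "\<dots> \<le> Re (\<theta> * L2_inner \<Omega> f y)"
    using B_coercive[OF \<kappa> yH] y yH by (simp add: solves_def)
  also have "\<dots> \<le> norm \<theta> * norm (L2_inner \<Omega> f y)"
    using complex_Re_le_cmod[of "\<theta> * L2_inner \<Omega> f y"] by (simp only: norm_mult)
  also have "\<dots> \<le> norm \<theta> * (L2_norm \<Omega> f * L2_norm \<Omega> y)"
    by (intro mult_left_mono L2_Cauchy_Schwarz f H0_curl_L2 yH) simp
  finally have "L2_norm \<Omega> y * (coerc * L2_norm \<Omega> y) \<le> L2_norm \<Omega> y * (norm \<theta> * L2_norm \<Omega> f)"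
    by (simp add: power2_eq_square algebra_simps)
  then have "coerc * L2_norm \<Omega> y \<le> norm \<theta> * L2_norm \<Omega> f"
    using coerc_pos by (cases "L2_norm \<Omega> y = 0") (auto simp: less_le)
  then show ?thesis using coerc_pos by (simp add: field_simps)
qed

text \<open>In the difference of the two equations \<open>f\<close> cancels, and
  \<open>y1 - y2\<close> solves the first equation with source
  \<open>\<omega>\<^sup>2 * (\<kappa>1 - \<kappa>2) * y2\<close>. One factor
  \<open>norm \<theta> / coerc\<close> comes from coercivity, the other from
  \<open>solution_bound\<close> for \<open>y2\<close>. Equal coefficients and
  \<open>\<delta> = 0\<close> give uniqueness up to seminorm zero.\<close>

lemma solution_stability:
  assumes \<kappa>1: "admissible \<kappa>1" and \<kappa>2: "admissible \<kappa>2"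
    and y1: "solves \<kappa>1 y1" and y2: "solves \<kappa>2 y2"
    and \<delta>: "AE x in lebesgue_on \<Omega>. norm (\<kappa>1 x - \<kappa>2 x) \<le> \<delta>" "\<delta> \<ge> 0"
  shows "graph.nrm (y1 - y2) \<le> (norm \<theta> * \<omega> / coerc)\<^sup>2 * L2_norm \<Omega> f * \<delta>"
proof -
  have H: "y1 \<in> H0_curl \<Omega>" "y2 \<in> H0_curl \<Omega>" using y1 y2 by (auto simp: solves_def)
  define d where "d = y1 - y2"
  have d: "d \<in> H0_curl \<Omega>" unfolding d_def by (rule H0_curl_diff[OF open_domain H])
  have meas: "(\<lambda>x. \<kappa>1 x - \<kappa>2 x) \<in> borel_measurable (lebesgue_on \<Omega>)"
    by (intro borel_measurable_diff admissibleD(1)[OF \<kappa>1] admissibleD(1)[OF \<kappa>2])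
  have "B \<kappa>1 d d = B \<kappa>2 y2 d - B \<kappa>1 y2 d"
    using B_diff_left[OF \<kappa>1 H d] y1 y2 d by (simp add: d_def[symmetric] solves_def)
  also have "\<dots> = of_real (\<omega>\<^sup>2) * (L2_inner \<Omega> (\<lambda>x. \<kappa>1 x *s y2 x) d - L2_inner \<Omega> (\<lambda>x. \<kappa>2 x *s y2 x) d)"
    by (simp add: B_def algebra_simps)
  also have "\<dots> = of_real (\<omega>\<^sup>2) * L2_inner \<Omega> ((\<lambda>x. \<kappa>1 x *s y2 x) - (\<lambda>x. \<kappa>2 x *s y2 x)) d"
    using \<kappa>1 \<kappa>2 H d by (simp only: L2_inner_diff_left \<kappa>_L2 H0_curl_L2)
  also have "(\<lambda>x. \<kappa>1 x *s y2 x) - (\<lambda>x. \<kappa>2 x *s y2 x) = (\<lambda>x. (\<kappa>1 x - \<kappa>2 x) *s y2 x)"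
    by (simp add: fun_eq_iff vec_eq_iff algebra_simps)
  finally have Bd: "B \<kappa>1 d d = of_real (\<omega>\<^sup>2) * L2_inner \<Omega> (\<lambda>x. (\<kappa>1 x - \<kappa>2 x) *s y2 x) d" .
  have "coerc * (graph.nrm d)\<^sup>2 \<le> Re (\<theta> * B \<kappa>1 d d)"
    using B_coercive[OF \<kappa>1 d] by (simp only: graph.nrm_square[OF d])
  also have "\<dots> \<le> norm \<theta> * (\<omega>\<^sup>2 * norm (L2_inner \<Omega> (\<lambda>x. (\<kappa>1 x - \<kappa>2 x) *s y2 x) d))"
    using complex_Re_le_cmod[of "\<theta> * B \<kappa>1 d d"] unfolding Bd by (simp add: norm_mult norm_power)
  also have "\<dots> \<le> norm \<theta> * (\<omega>\<^sup>2 * ((\<delta> * (norm \<theta> * L2_norm \<Omega> f / coerc)) * graph.nrm d))"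
  proof (intro mult_left_mono)
    have "norm (L2_inner \<Omega> (\<lambda>x. (\<kappa>1 x - \<kappa>2 x) *s y2 x) d) \<le> L2_norm \<Omega> (\<lambda>x. (\<kappa>1 x - \<kappa>2 x) *s y2 x) * L2_norm \<Omega> d"
      by (rule L2_Cauchy_Schwarz[OF L2_mult_bounded[OF H0_curl_L2[OF H(2)] meas \<delta>(1)] H0_curl_L2[OF d]])
    also have "\<dots> \<le> (\<delta> * L2_norm \<Omega> y2) * graph.nrm d"
      using \<delta>(2) by (intro mult_mono L2_norm_mult_bounded[OF H0_curl_L2[OF H(2)] meas \<delta>] L2_norm_le_graph) auto
    also have "\<dots> \<le> (\<delta> * (norm \<theta> * L2_norm \<Omega> f / coerc)) * graph.nrm d"
      using \<delta>(2) graph.nrm_ge_0[OF d] by (intro mult_right_mono mult_left_mono solution_bound[OF \<kappa>2 y2])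
    finally show "norm (L2_inner \<Omega> (\<lambda>x. (\<kappa>1 x - \<kappa>2 x) *s y2 x) d)
      \<le> (\<delta> * (norm \<theta> * L2_norm \<Omega> f / coerc)) * graph.nrm d" .
  qed auto
  finally have "graph.nrm d * (coerc * graph.nrm d)
      \<le> graph.nrm d * (norm \<theta> * (\<omega>\<^sup>2 * (\<delta> * (norm \<theta> * L2_norm \<Omega> f / coerc))))"
    by (simp add: power2_eq_square algebra_simps)
  \<comment> \<open>Settles the case \<open>graph.nrm d = 0\<close>, in which the common factor
    cannot be cancelled.\<close>
  moreover have "0 \<le> norm \<theta> * (\<omega>\<^sup>2 * (\<delta> * (norm \<theta> * L2_norm \<Omega> f / coerc)))"
    using coerc_pos \<delta>(2) by simp
  ultimately have "coerc * graph.nrm d \<le> norm \<theta> * (\<omega>\<^sup>2 * (\<delta> * (norm \<theta> * L2_norm \<Omega> f / coerc)))"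
    using graph.nrm_ge_0[OF d] by (metis mult_le_cancel_left_pos mult_zero_right order_le_less)
  then show ?thesis
    using coerc_pos by (simp add: d_def field_simps power2_eq_square)
qed

end

subsection \<open>The optimal control problem\<close>

lemma borel_measurable_complex_of_real:
  "f \<in> borel_measurable M \<Longrightarrow> (\<lambda>x. complex_of_real (f x)) \<in> borel_measurable M"
  by (rule borel_measurable_continuous_on[OF continuous_on_of_real[OF continuous_on_id]])

text \<open>Replaces the definite description by a finite sum of indicators, from which
  measurability can be read off. The leading 1 is the factor on the interfaces.\<close>

lemma piecewise_scale_eq:
  assumes disj: "\<And>j k. j \<noteq> k \<Longrightarrow> P j \<inter> P k = {}"
  shows "piecewise_scale P c u x = of_real (1 + (\<Sum>k\<in>UNIV. indicator (P k) x * (u $ k - 1))) * c x"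
proof (cases "\<exists>k. x \<in> P k")
  case True
  then obtain k where k: "x \<in> P k" by blast
  then have eq: "x \<in> P j \<longleftrightarrow> j = k" for j using disj by blast
  have "(\<Sum>j\<in>UNIV. indicator (P j) x * (u $ j - 1)) = (\<Sum>j\<in>UNIV. if j = k then u $ k - 1 else 0)"
    by (intro sum.cong) (auto simp: indicator_def eq)
  then show ?thesis by (simp add: piecewise_scale_def eq)
next
  case False
  then show ?thesis by (simp add: piecewise_scale_def)
qed

text \<open>The case is decided by \<open>x\<close> before any control is chosen: one
  \<open>k\<close> serves all \<open>u\<close>, so the coefficients of two controls can be compared
  at a point.\<close>

lemma piecewise_scale_cases:
  obtains k where "\<And>u. piecewise_scale P c u x = of_real (u $ k) * c x"
  | "\<And>u. piecewise_scale P c u x = c x"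
  by (cases "\<exists>k. x \<in> P k") (auto simp: piecewise_scale_def)

lemma borel_measurable_piecewise_scale:
  fixes P :: "'l::finite \<Rightarrow> (real^3) set"
  assumes P: "\<And>k. P k \<in> sets lebesgue" "\<And>j k. j \<noteq> k \<Longrightarrow> P j \<inter> P k = {}"
    and c: "c \<in> borel_measurable (lebesgue_on \<Omega>)"
  shows "piecewise_scale P c u \<in> borel_measurable (lebesgue_on \<Omega>)"
proof -
  have "indicat_real (P k) \<in> borel_measurable (lebesgue_on \<Omega>)" for k
    using P(1) by (intro measurable_restrict_space1 borel_measurable_indicator)
  moreover have "piecewise_scale P c u = (\<lambda>x. of_real (1 + (\<Sum>k\<in>UNIV. indicator (P k) x * (u $ k - 1))) * c x)"
    by (intro ext piecewise_scale_eq P(2))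
  moreover have "(\<lambda>x. 1 + (\<Sum>k\<in>UNIV. indicat_real (P k) x * (u $ k - 1))) \<in> borel_measurable (lebesgue_on \<Omega>)"
    using calculation(1)
    by (intro borel_measurable_add borel_measurable_sum borel_measurable_times borel_measurable_const)
  ultimately show ?thesis
    using c by (simp only: borel_measurable_times borel_measurable_complex_of_real)
qed

lemma L2_norm_diff_le:
  assumes "v \<in> L2 \<Omega>" "w \<in> L2 \<Omega>" "z \<in> L2 \<Omega>"
  shows "\<bar>L2_norm \<Omega> (v - z) - L2_norm \<Omega> (w - z)\<bar> \<le> L2_norm \<Omega> (v - w)"
  using L2.nrm_diff_triangle[OF assms(1,2,3)] L2.nrm_diff_triangle[OF assms(2,1,3)]
    L2_norm_diff_commute[OF assms(1,2)]
  by (simp add: L2_nrm)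

lemma cost_eq:
  "cost \<Omega> \<alpha> yd Ed y u = 1/2 * (L2_norm \<Omega> (y - yd))\<^sup>2 + 1/2 * (L2_norm \<Omega> (curl \<Omega> y - Ed))\<^sup>2 + \<alpha>/2 * (norm u)\<^sup>2"
  by (simp add: cost_def fun_diff_def)

lemma U_ad_eq_cbox: "U_ad a b = cbox a b"
  by (auto simp: U_ad_def mem_box_cart)

section \<open>Minimization for an abstract Lipschitz family of coefficients\<close>

context maxwell begin

lemma solution_diff_norms:
  assumes "solves \<kappa>1 y1" "solves \<kappa>2 y2" "v \<in> L2 \<Omega>"
  shows "\<bar>L2_norm \<Omega> (y1 - v) - L2_norm \<Omega> (y2 - v)\<bar> \<le> graph.nrm (y1 - y2)"
    and "\<bar>L2_norm \<Omega> (curl \<Omega> y1 - v) - L2_norm \<Omega> (curl \<Omega> y2 - v)\<bar> \<le> graph.nrm (y1 - y2)"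
proof -
  have H: "y1 \<in> H0_curl \<Omega>" "y2 \<in> H0_curl \<Omega>" using assms by (auto simp: solves_def)
  have "L2_norm \<Omega> (curl \<Omega> y1 - curl \<Omega> y2) \<le> graph.nrm (y1 - y2)"
    by (simp add: graph.nrm_def graph_norm_diff[OF open_domain H] real_le_rsqrt)
  then show "\<bar>L2_norm \<Omega> (curl \<Omega> y1 - v) - L2_norm \<Omega> (curl \<Omega> y2 - v)\<bar> \<le> graph.nrm (y1 - y2)"
    using L2_norm_diff_le[OF H0_curl_curl_L2[OF H(1)] H0_curl_curl_L2[OF H(2)] assms(3)] by linarith
  show "\<bar>L2_norm \<Omega> (y1 - v) - L2_norm \<Omega> (y2 - v)\<bar> \<le> graph.nrm (y1 - y2)"
    using L2_norm_diff_le[OF H0_curl_L2[OF H(1)] H0_curl_L2[OF H(2)] assms(3)] L2_norm_le_graph(1)[of "y1 - y2"]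
    by linarith
qed

text \<open>The reduced cost is formed with one chosen state \<open>Y u\<close> per control. Its two
  norms vary by at most the graph seminorm of the difference of states, hence are Lipschitz in the
  control.\<close>

lemma ex_minimizer:
  fixes \<kappa> :: "real^'l::finite \<Rightarrow> real^3 \<Rightarrow> complex" and U :: "(real^'l) set"
  assumes U: "compact U" "U \<noteq> {}"
    and adm: "\<And>u. u \<in> U \<Longrightarrow> admissible (\<kappa> u)"
    and lip: "\<And>u v. u \<in> U \<Longrightarrow> v \<in> U \<Longrightarrow> AE x in lebesgue_on \<Omega>. norm (\<kappa> u x - \<kappa> v x) \<le> L * norm (u - v)"
    and L: "L \<ge> 0" and yd: "yd \<in> L2 \<Omega>" and Ed: "Ed \<in> L2 \<Omega>"
  shows "\<exists>ystar ustar. ustar \<in> U \<and> solves (\<kappa> ustar) ystar \<and>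
    (\<forall>u\<in>U. \<forall>y. solves (\<kappa> u) y \<longrightarrow> cost \<Omega> \<alpha> yd Ed ystar ustar \<le> cost \<Omega> \<alpha> yd Ed y u)"
proof -
  define Y where "Y u = (SOME y. solves (\<kappa> u) y)" for u
  have Y: "solves (\<kappa> u) (Y u)" if "u \<in> U" for u
    unfolding Y_def using ex_solution[OF adm[OF that]] by (rule someI_ex)
  define K where "K = (norm \<theta> * \<omega> / coerc)\<^sup>2 * L2_norm \<Omega> f * L"
  have K: "K \<ge> 0" using L by (simp add: K_def)
  have stab: "graph.nrm (y - z) \<le> K * norm (u - v)"
    if "u \<in> U" "v \<in> U" "solves (\<kappa> u) y" "solves (\<kappa> v) z" for u v y z
    using solution_stability[OF adm[OF that(1)] adm[OF that(2)] that(3,4) lip[OF that(1,2)]] L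
    by (simp add: K_def mult.assoc)
  have lipschitz: "K-lipschitz_on U h"
    if "\<And>u v. u \<in> U \<Longrightarrow> v \<in> U \<Longrightarrow> \<bar>h u - h v\<bar> \<le> graph.nrm (Y u - Y v)" for h :: "real^'l \<Rightarrow> real"
    using K order_trans[OF that stab[OF _ _ Y Y]] by (intro lipschitz_onI) (auto simp: dist_norm)
  have "continuous_on U (\<lambda>u. L2_norm \<Omega> (Y u - yd))"
    by (rule lipschitz_on_continuous_on[OF lipschitz]) (rule solution_diff_norms(1)[OF Y Y yd])
  moreover have "continuous_on U (\<lambda>u. L2_norm \<Omega> (curl \<Omega> (Y u) - Ed))"
    by (rule lipschitz_on_continuous_on[OF lipschitz]) (rule solution_diff_norms(2)[OF Y Y Ed])
  ultimately have "continuous_on U (\<lambda>u. cost \<Omega> \<alpha> yd Ed (Y u) u)"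
    unfolding cost_eq by (intro continuous_intros)
  then obtain u0 where u0: "u0 \<in> U" and min: "\<And>u. u \<in> U \<Longrightarrow> cost \<Omega> \<alpha> yd Ed (Y u0) u0 \<le> cost \<Omega> \<alpha> yd Ed (Y u) u"
    using continuous_attains_inf[OF U] by blast
  \<comment> \<open>The minimum must be compared with every solution, not only with the chosen one.
    Stability with equal controls makes their difference a vector of graph seminorm zero, which the
    cost does not detect.\<close>
  have "cost \<Omega> \<alpha> yd Ed (Y u) u = cost \<Omega> \<alpha> yd Ed y u" if u: "u \<in> U" and y: "solves (\<kappa> u) y" for u y
  proof -
    have "graph.nrm (Y u - y) \<le> 0" using stab[OF u u Y[OF u] y] by simp
    then have "L2_norm \<Omega> (Y u - yd) = L2_norm \<Omega> (y - yd)"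
      "L2_norm \<Omega> (curl \<Omega> (Y u) - Ed) = L2_norm \<Omega> (curl \<Omega> y - Ed)"
      using solution_diff_norms(1)[OF Y[OF u] y yd] solution_diff_norms(2)[OF Y[OF u] y Ed] by linarith+
    then show ?thesis by (simp add: cost_eq)
  qed
  then show ?thesis using u0 Y[OF u0] min by (metis (no_types, lifting))
qed

end

theorem theorem4p4:
  fixes \<Omega> :: "(real^3) set"
    and P :: "'l::finite \<Rightarrow> (real^3) set"
    and \<omega> \<mu>0 \<epsilon>min \<epsilon>max \<sigma>min \<sigma>max \<alpha> :: real
    and \<mu> \<epsilon> \<sigma> :: "real^3 \<Rightarrow> real"
    and f y\<^sub>\<Omega> E\<^sub>\<Omega> :: "real^3 \<Rightarrow> complex^3"
    and a b :: "real^'l"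
  assumes domain: "polyhedral_domain \<Omega>" "bounded \<Omega>" "simply_connected \<Omega>" "lipschitz_boundary \<Omega>"
    and partition: "subdomain_partition \<Omega> P"
    and omega: "\<omega> > 0"
    and mu: "\<mu> \<in> Linfty \<Omega>" "\<mu>0 > 0" "AE x in lebesgue_on \<Omega>. \<mu>0 \<le> \<mu> x"
    and eps: "\<epsilon> \<in> Linfty \<Omega>" "\<epsilon>min > 0"
      "AE x in lebesgue_on \<Omega>. \<epsilon>min \<le> \<epsilon> x \<and> \<epsilon> x \<le> \<epsilon>max"
    and sigma: "\<sigma> \<in> Linfty \<Omega>" "\<sigma>min > 0"
      "AE x in lebesgue_on \<Omega>. \<sigma>min \<le> \<sigma> x \<and> \<sigma> x \<le> \<sigma>max"
    and data: "f \<in> L2 \<Omega>" "y\<^sub>\<Omega> \<in> L2 \<Omega>" "E\<^sub>\<Omega> \<in> L2 \<Omega>" "\<alpha> > 0"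
    and bounds: "\<And>k. 0 < a $ k" "\<And>k. a $ k < b $ k"
  shows "\<exists>ystar\<in>H0_curl \<Omega>. \<exists>ustar\<in>U_ad a b.
    state_equation \<Omega> P \<omega> \<mu> (complex_permittivity \<omega> \<epsilon> \<sigma>) f ystar ustar \<and>
    (\<forall>y\<in>H0_curl \<Omega>. \<forall>u\<in>U_ad a b.
       state_equation \<Omega> P \<omega> \<mu> (complex_permittivity \<omega> \<epsilon> \<sigma>) f y u \<longrightarrow>
       cost \<Omega> \<alpha> y\<^sub>\<Omega> E\<^sub>\<Omega> ystar ustar \<le> cost \<Omega> \<alpha> y\<^sub>\<Omega> E\<^sub>\<Omega> y u)"
proof -
  have open_\<Omega>: "open \<Omega>" using domain(1) by (simp add: polyhedral_domain_def)
  have lm: "\<Omega> \<in> lmeasurable" by (rule lmeasurable_open[OF domain(2) open_\<Omega>])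
  have P: "\<And>k. P k \<in> sets lebesgue" "\<And>j k. j \<noteq> k \<Longrightarrow> P j \<inter> P k = {}"
    using partition by (auto simp: subdomain_partition_def)
  define c where "c = complex_permittivity \<omega> \<epsilon> \<sigma>"
  have c_meas: "c \<in> borel_measurable (lebesgue_on \<Omega>)"
    using eps(1) sigma(1) unfolding c_def complex_permittivity_def[abs_def] Linfty_def
    by (intro borel_measurable_add borel_measurable_times borel_measurable_complex_of_real borel_measurable_const) auto
  obtain C\<mu> where C\<mu>: "AE x in lebesgue_on \<Omega>. \<bar>\<mu> x\<bar> \<le> C\<mu>" using mu(1) by (auto simp: Linfty_def)
  define \<nu> where "\<nu> x = complex_of_real (inverse (\<mu> x))" for x
  \<comment> \<open>The value 1 is inserted because it is the factor of the coefficient on the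
    interfaces; \<open>lo\<close> and \<open>hi\<close> thus bound the scaling factor
    everywhere.\<close>
  define lo where "lo = Min (insert 1 (range (($) a)))"
  define hi where "hi = Max (insert 1 (range (($) b)))"
  have lo: "lo \<le> 1" "\<And>k. lo \<le> a $ k" unfolding lo_def by (rule Min_le; simp)+
  have lo_pos: "lo > 0" using bounds(1) by (auto simp: lo_def)
  have hi: "1 \<le> hi" "\<And>k. b $ k \<le> hi" unfolding hi_def by (rule Max_ge; simp)+
  \<comment> \<open>Bounds the sum of the absolute values of real and imaginary part of
    \<open>c\<close>, hence its modulus. It is also the Lipschitz constant of the coefficient in the
    control.\<close>
  define E where "E = max 0 \<epsilon>max + max 0 \<sigma>max / \<omega>"
  have E: "E \<ge> 0" using omega by (simp add: E_def)
  have c_bounds: "AE x in lebesgue_on \<Omega>. norm (c x) \<le> E \<and> 0 \<le> Re (c x) \<and> Re (c x) \<le> max 0 \<epsilon>max \<and> \<sigma>min / \<omega> \<le> Im (c x)"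
    using eps(3) sigma(3)
  proof eventually_elim
    fix x assume e: "\<epsilon>min \<le> \<epsilon> x \<and> \<epsilon> x \<le> \<epsilon>max" and s: "\<sigma>min \<le> \<sigma> x \<and> \<sigma> x \<le> \<sigma>max"
    have re: "Re (c x) = \<epsilon> x" and im: "Im (c x) = \<sigma> x / \<omega>"
      using omega by (simp_all add: c_def complex_permittivity_def divide_inverse power2_eq_square)
    have "norm (c x) \<le> \<bar>Re (c x)\<bar> + \<bar>Im (c x)\<bar>" by (rule cmod_le)
    also have "\<dots> \<le> E" unfolding re im E_def
      using e s eps(2) sigma(2) omega by (intro add_mono) (auto simp: divide_le_cancel)
    finally show "norm (c x) \<le> E \<and> 0 \<le> Re (c x) \<and> Re (c x) \<le> max 0 \<epsilon>max \<and> \<sigma>min / \<omega> \<le> Im (c x)"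
      using e s eps(2) omega by (auto simp: re im divide_right_mono)
  qed
  \<comment> \<open>The lower bound of \<open>\<nu>\<close> comes from the essential bound
    \<open>C\<mu>\<close>, with \<open>\<mu>0\<close> in the maximum to keep it positive. The lower
    bound \<open>lo * (\<sigma>min / \<omega>)\<close> of the imaginary part is positive because the
    controls are bounded below by the positive \<open>a\<close>.\<close>
  interpret maxwell \<Omega> \<nu> \<omega> "inverse (max C\<mu> \<mu>0)" "inverse \<mu>0" "hi * E" "hi * max 0 \<epsilon>max" "lo * (\<sigma>min / \<omega>)" f
  proof
    show "\<nu> \<in> borel_measurable (lebesgue_on \<Omega>)"
      unfolding \<nu>_def using mu(1) unfolding Linfty_def
      by (intro borel_measurable_complex_of_real borel_measurable_inverse) auto
    show "AE x in lebesgue_on \<Omega>. norm (\<nu> x) \<le> inverse \<mu>0"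
      using mu(3) by eventually_elim (use mu(2) in \<open>auto simp: \<nu>_def norm_inverse intro: le_imp_inverse_le\<close>)
    show "AE x in lebesgue_on \<Omega>. Im (\<nu> x) = 0 \<and> inverse (max C\<mu> \<mu>0) \<le> Re (\<nu> x)"
      using mu(3) C\<mu>
    proof eventually_elim
      fix x assume "\<mu>0 \<le> \<mu> x" "\<bar>\<mu> x\<bar> \<le> C\<mu>"
      then have "inverse (max C\<mu> \<mu>0) \<le> inverse (\<mu> x)" using mu(2) by (intro le_imp_inverse_le) auto
      then show "Im (\<nu> x) = 0 \<and> inverse (max C\<mu> \<mu>0) \<le> Re (\<nu> x)"
        unfolding \<nu>_def Re_complex_of_real Im_complex_of_real by simp
    qed
  qed (use open_\<Omega> lm omega mu(2) hi lo_pos sigma(2) data(1) in auto)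
  have adm: "admissible (piecewise_scale P c u)" if u: "u \<in> U_ad a b" for u
    unfolding admissible_def
  proof
    show "piecewise_scale P c u \<in> borel_measurable (lebesgue_on \<Omega>)"
      by (rule borel_measurable_piecewise_scale[OF P c_meas])
    show "AE x in lebesgue_on \<Omega>. norm (piecewise_scale P c u x) \<le> hi * E \<and>
        Re (piecewise_scale P c u x) \<le> hi * max 0 \<epsilon>max \<and> lo * (\<sigma>min / \<omega>) \<le> Im (piecewise_scale P c u x)"
      using c_bounds
    proof eventually_elim
      fix x assume x: "norm (c x) \<le> E \<and> 0 \<le> Re (c x) \<and> Re (c x) \<le> max 0 \<epsilon>max \<and> \<sigma>min / \<omega> \<le> Im (c x)"
      obtain s where s: "piecewise_scale P c u x = of_real s * c x" "lo \<le> s" "s \<le> hi"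
      proof (cases rule: piecewise_scale_cases[of P c x])
        case (1 k)
        then show ?thesis using u lo(2)[of k] hi(2)[of k] by (intro that[of "u $ k"]) (auto simp: U_ad_def intro: order_trans)
      next
        case 2
        then show ?thesis using lo hi by (intro that[of 1]) auto
      qed
      have "s * norm (c x) \<le> hi * E" "s * Re (c x) \<le> hi * max 0 \<epsilon>max"
        using x s lo_pos hi(1) by (auto intro!: mult_mono)
      moreover have "lo * (\<sigma>min / \<omega>) \<le> s * Im (c x)"
        using x s lo_pos sigma(2) omega by (intro mult_mono) auto
      ultimately show "norm (piecewise_scale P c u x) \<le> hi * E \<and>
        Re (piecewise_scale P c u x) \<le> hi * max 0 \<epsilon>max \<and> lo * (\<sigma>min / \<omega>) \<le> Im (piecewise_scale P c u x)"
        using s lo_pos by (simp add: s(1) norm_mult)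
    qed
  qed
  have lip: "AE x in lebesgue_on \<Omega>. norm (piecewise_scale P c u x - piecewise_scale P c v x) \<le> E * norm (u - v)" for u v
    using c_bounds
  proof eventually_elim
    fix x assume x: "norm (c x) \<le> E \<and> 0 \<le> Re (c x) \<and> Re (c x) \<le> max 0 \<epsilon>max \<and> \<sigma>min / \<omega> \<le> Im (c x)"
    show "norm (piecewise_scale P c u x - piecewise_scale P c v x) \<le> E * norm (u - v)"
    proof (cases rule: piecewise_scale_cases[of P c x])
      case (1 k)
      have "piecewise_scale P c u x - piecewise_scale P c v x = of_real ((u - v) $ k) * c x"
        by (simp add: 1 algebra_simps)
      also have "norm \<dots> = \<bar>(u - v) $ k\<bar> * norm (c x)" by (simp only: norm_mult norm_of_real)
      also have "\<dots> \<le> norm (u - v) * E"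
        using x by (intro mult_mono component_le_norm_cart) auto
      finally show ?thesis by (simp add: mult.commute)
    next
      case 2
      then show ?thesis using E by simp
    qed
  qed
  \<comment> \<open>The abstract form uses complex multiplication by \<open>\<nu>\<close>, the state
    equation real scaling by the inverse of \<open>\<mu>\<close>; the two agree pointwise.\<close>
  have solves_iff: "solves (piecewise_scale P c u) y \<longleftrightarrow> y \<in> H0_curl \<Omega> \<and> state_equation \<Omega> P \<omega> \<mu> c f y u" for u y
  proof -
    have "(\<lambda>x. \<nu> x *s curl \<Omega> y x) = (\<lambda>x. inverse (\<mu> x) *\<^sub>R curl \<Omega> y x)"
      by (simp add: \<nu>_def fun_eq_iff vec_eq_iff scaleR_conv_of_real[where 'a = complex])
    then show ?thesis by (simp only: solves_def B_def state_equation_def)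
  qed
  have "U_ad a b \<noteq> {}" using bounds(2) by (auto simp: U_ad_def intro!: exI[of _ a] less_imp_le)
  then obtain y u where "u \<in> U_ad a b" "solves (piecewise_scale P c u) y"
    "\<And>v z. v \<in> U_ad a b \<Longrightarrow> solves (piecewise_scale P c v) z \<Longrightarrow> cost \<Omega> \<alpha> y\<^sub>\<Omega> E\<^sub>\<Omega> y u \<le> cost \<Omega> \<alpha> y\<^sub>\<Omega> E\<^sub>\<Omega> z v"
    using ex_minimizer[of "U_ad a b" "piecewise_scale P c" E y\<^sub>\<Omega> E\<^sub>\<Omega> \<alpha>] adm lip E data(2,3) compact_cbox[of a b]
    unfolding U_ad_eq_cbox by blast
  then show ?thesis unfolding solves_iff unfolding c_def by blast
qed

end
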